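(* Let $0<c<1$. Let $\mathbf a=(a_n)_{n=1}^\infty$ be any sequence of complex numbers with $|a_n|=1$ for all $n$, and define $$\mathcal F_{\mathbf a,c}(4)=\Big\{x\in[0,1):~ \Big|\sum_{n=1}^N a_n\,\mathbf e(xn^4)\Big|\geqslant cN^{1/2}\ \text{for infinitely many } N\in\mathbb N\Big\}.$$ Then for every interval $\mathfrak I\subseteq[0,1)$, $$\lambda\big(\mathcal F_{\mathbf a,c}(4)\cap\mathfrak I\big)\geqslant \frac{\big(\lambda(\mathfrak I)(1-c^2)\big)^2}{8},$$ where $\lambda$ denotes Lebesgue measure.
   Context: $\mathbf e(x)=\exp(2\pi i x)$. The torus $\mathbb R/\mathbb Z$ is identified with $[0,1)$. *)

theory Defs
  imports "HOL-Analysis.Analysis"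
begin

definition e :: "real \<Rightarrow> complex" where
  "e x = exp (2 * of_real pi * \<i> * of_real x)"

text \<open>The sequence is indexed from 1: the value \<open>a 0\<close> is never used.\<close>

definition weyl_sum :: "(nat \<Rightarrow> complex) \<Rightarrow> nat \<Rightarrow> nat \<Rightarrow> real \<Rightarrow> complex" where
  "weyl_sum a d N x = (\<Sum>n = 1..N. a n * e (x * real n ^ d))"

definition F :: "(nat \<Rightarrow> complex) \<Rightarrow> real \<Rightarrow> nat \<Rightarrow> real set" where
  "F a c d = {x \<in> {0..<1}. infinite {N. norm (weyl_sum a d N x) \<ge> c * sqrt (real N)}}"

end

theory Submission
  imports Defs "HOL-Computational_Algebra.Primes" "HOL-Real_Asymp.Real_Asymp"
begin

text \<open>
  The set in fact has full measure in every interval. Otherwise, some set \<open>G\<close> of positive measure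
  and some \<open>K\<close> satisfy \<open>\<bar>S\<^sub>N(x)\<bar> < c \<surd>N\<close> for all \<open>x \<in> G\<close>, \<open>N \<ge> K\<close>, so
  that the integral of \<open>\<bar>S\<^sub>N\<bar>\<^sup>2\<close> over \<open>G\<close> is at most \<open>c\<^sup>2 N \<lambda>(G)\<close>. Expanding the square, this integral is
  \<open>N \<lambda>(G)\<close> plus a sum over pairs \<open>m \<noteq> n\<close> of Fourier coefficients of the indicator function of \<open>G\<close>
  at \<open>m\<^sup>4 - n\<^sup>4\<close>. These coefficients are square summable, so by Cauchy-Schwarz the sum is \<open>o(N)\<close>
  along every sequence of \<open>N\<close> for which \<open>n\<^sup>4 - m\<^sup>4 = n'\<^sup>4 - m'\<^sup>4\<close> has \<open>O(N\<^sup>2)\<close> solutions up to \<open>N\<close>.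

  For the count put \<open>x = n - m\<close>, \<open>y = n + m\<close>, \<open>z = n' - m'\<close>, \<open>w = n' + m'\<close>, which turns the equation into
  \<open>x y (x\<^sup>2 + y\<^sup>2) = z w (z\<^sup>2 + w\<^sup>2)\<close>, and distinguish the size of the gcds of \<open>x\<close>, \<open>y\<close> with \<open>z\<close>, \<open>w\<close>.
  If one of them, say \<open>h = gcd(x, z)\<close>, is large, write \<open>x = h a\<close>, \<open>z = h b\<close>, \<open>y = k u\<close>, \<open>w = k v\<close> with
  \<open>k = gcd(y, w)\<close>: then \<open>b\<^sup>3 v - a\<^sup>3 u\<close> divides \<open>k\<^sup>2 a b\<^bsup>10\<^esup> (b\<^sup>8 - a\<^sup>8)\<close>, and the divisor bound applies.
  If all are small, the ratio \<open>t / g = (z\<^sup>2 + w\<^sup>2) / (x y) = (x\<^sup>2 + y\<^sup>2) / (z w)\<close> has few values, and for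
  given \<open>g\<close>, \<open>t\<close> and \<open>x + y\<close> the point \<open>(y - x, w - z)\<close> lies on an ellipse, which contains few lattice points.
\<close>

section \<open>The divisor bound and lattice points on ellipses\<close>

abbreviation tau :: "nat \<Rightarrow> nat" where
  "tau n \<equiv> card {d. d dvd n}"

text \<open>A divisor of \<open>p ^ k * m\<close> splits as a divisor \<open>p ^ i\<close> of
  \<open>p ^ k\<close> times a divisor of \<open>m\<close>. Only an upper bound is wanted, so
  \<open>p\<close> may divide \<open>m\<close> and different splittings may coincide.\<close>

lemma tau_prime_power_mult:
  fixes p k m :: nat
  assumes "prime p" "m > 0"
  shows "tau (p ^ k * m) \<le> (k + 1) * tau m"
proof -
  have "{d. d dvd p ^ k * m} \<subseteq> (\<lambda>(i, d). p ^ i * d) ` ({..k} \<times> {d. d dvd m})"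
  proof
    fix d assume "d \<in> {d. d dvd p ^ k * m}"
    then obtain b c where bc: "d = b * c" "b dvd p ^ k" "c dvd m"
      using division_decomp by blast
    then obtain i where "i \<le> k" "b = p ^ i"
      using assms(1) divides_primepow_nat by blast
    then show "d \<in> (\<lambda>(i, d). p ^ i * d) ` ({..k} \<times> {d. d dvd m})"
      using bc by force
  qed
  then have "tau (p ^ k * m) \<le> card ((\<lambda>(i, d). p ^ i * d) ` ({..k} \<times> {d. d dvd m}))"
    using assms by (intro card_mono) auto
  also have "\<dots> \<le> card ({..k} \<times> {d. d dvd m})"
    using assms by (intro card_image_le) auto
  finally show ?thesis by (simp add: card_cartesian_product)
qed

text \<open>This constant is the price paid for each prime below \<open>2 ^ j\<close> in the divisor
  bound.\<close>

lemma power_le_const_times_two_power: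
  fixes j :: nat
  obtains C :: nat where "C \<ge> 1" "\<And>k. (k + 1) ^ j \<le> C * 2 ^ k"
proof -
  have "(\<lambda>k. real (k + 1) ^ j / 2 ^ k) \<longlonglongrightarrow> 0"
    by real_asymp
  then have "Bseq (\<lambda>k. real (k + 1) ^ j / 2 ^ k)"
    by (intro convergent_imp_Bseq convergentI)
  then obtain K where K: "norm (real (k + 1) ^ j / 2 ^ k) \<le> K" for k
    unfolding Bseq_def by blast
  define C where "C = nat \<lceil>max K 1\<rceil>"
  have C: "real C \<ge> K" "C \<ge> 1"
    unfolding C_def by linarith+
  have "(k + 1) ^ j \<le> C * 2 ^ k" for k
  proof -
    have "real (k + 1) ^ j / 2 ^ k \<le> C"
      using K[of k] C by simp
    then have "real ((k + 1) ^ j) \<le> real (C * 2 ^ k)"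
      by (simp add: field_simps)
    then show ?thesis by (simp only: of_nat_le_iff)
  qed
  then show thesis using C that by blast
qed

text \<open>Induction on the bound \<open>s\<close> for the prime divisors, splitting off the full
  power \<open>s ^ k\<close>. If \<open>s >= 2 ^ j\<close>, then
  \<open>(k + 1) ^ j <= (2 ^ k) ^ j <= s ^ k\<close>, so large primes cost nothing. A smaller prime
  costs one factor \<open>C\<close>. Hence the exponent of \<open>C\<close> stops growing at
  \<open>2 ^ j\<close>, which makes the bound uniform in \<open>s\<close>.\<close>

lemma tau_power_le_of_prime_divisors_less:
  fixes n :: nat
  assumes "C \<ge> 1" and C: "\<And>k. (k + 1) ^ j \<le> C * 2 ^ k"
    and "n > 0" and "\<And>p. prime p \<Longrightarrow> p dvd n \<Longrightarrow> p < s"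
  shows "tau n ^ j \<le> C ^ min s (2 ^ j) * n"
  using assms(3,4)
proof (induction s arbitrary: n)
  case 0
  then have "n = 1"
    using prime_factor_nat by blast
  then show ?case by simp
next
  case (Suc s)
  have mono: "C ^ min s (2 ^ j) \<le> C ^ min (Suc s) (2 ^ j)"
    using assms(1) by (intro power_increasing) auto
  show ?case
  proof (cases "prime s")
    case False
    then have "\<And>p. prime p \<Longrightarrow> p dvd n \<Longrightarrow> p < s"
      using Suc.prems(2) less_Suc_eq by blast
    from Suc.IH[OF Suc.prems(1) this] mono show ?thesis
      by (meson le_trans mult_le_mono1)
  next
    case True
    define k where "k = multiplicity s n"
    obtain m where m: "n = s ^ k * m" "\<not> s dvd m"
      using multiplicity_decompose'[of n s] Suc.prems(1) True k_def
      by (metis not_prime_unit not_gr_zero)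
    have "m > 0" using m Suc.prems(1) by (simp add: gr0I)
    have "p < s" if "prime p" "p dvd m" for p
      using Suc.prems(2)[of p] that m by (metis dvd_mult less_SucE)
    then have IH: "tau m ^ j \<le> C ^ min s (2 ^ j) * m"
      using Suc.IH \<open>m > 0\<close> by blast
    have step: "(k + 1) ^ j * C ^ min s (2 ^ j) \<le> C ^ min (Suc s) (2 ^ j) * s ^ k"
    proof (cases "s \<ge> 2 ^ j")
      case True
      have "(k + 1) ^ j \<le> (2 ^ k) ^ j"
        by (intro power_mono) (use less_exp[of k] in linarith)+
      also have "\<dots> = (2 ^ j) ^ k"
        by (simp add: mult.commute flip: power_mult)
      also have "\<dots> \<le> s ^ k"
        using True by (intro power_mono) auto
      finally show ?thesis
        using mono by (simp add: mult_le_mono mult.commute)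
    next
      case False
      have "(k + 1) ^ j \<le> C * 2 ^ k" by (rule C)
      also have "\<dots> \<le> C * s ^ k"
        using prime_ge_2_nat[OF \<open>prime s\<close>] by (intro mult_le_mono power_mono) auto
      finally have "(k + 1) ^ j * C ^ min s (2 ^ j) \<le> C * s ^ k * C ^ min s (2 ^ j)"
        by (rule mult_le_mono1)
      then show ?thesis
        using False by (simp add: min_def mult_ac)
    qed
    have "tau n ^ j \<le> ((k + 1) * tau m) ^ j"
      unfolding m(1) using tau_prime_power_mult[OF True \<open>m > 0\<close>] by (rule power_mono) simp
    also have "\<dots> \<le> (k + 1) ^ j * (C ^ min s (2 ^ j) * m)"
      unfolding power_mult_distrib using IH by (rule mult_le_mono2)
    also have "\<dots> \<le> C ^ min (Suc s) (2 ^ j) * n"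
      using mult_le_mono1[OF step, of m] by (simp add: m(1) mult_ac)
    finally show ?thesis .
  qed
qed

text \<open>The classical bound \<open>tau n = O(n^(1/j))\<close> for every \<open>j\<close>, raised
  to the power \<open>j\<close> to remain within the natural numbers.\<close>

proposition tau_power_le:
  obtains C :: nat where "C \<ge> 1" "\<And>n. n > 0 \<Longrightarrow> tau n ^ j \<le> C * n"
proof -
  obtain C :: nat where C: "C \<ge> 1" "\<And>k. (k + 1) ^ j \<le> C * 2 ^ k"
    using power_le_const_times_two_power by blast
  have "tau n ^ j \<le> C ^ (2 ^ j) * n" if "n > 0" for n
  proof -
    have "tau n ^ j \<le> C ^ min (Suc n) (2 ^ j) * n"
      using C that by (intro tau_power_le_of_prime_divisors_less) (auto dest: dvd_imp_le)
    also have "\<dots> \<le> C ^ (2 ^ j) * n"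
      using C(1) by (intro mult_le_mono1 power_increasing) auto
    finally show ?thesis .
  qed
  moreover have "C ^ (2 ^ j) \<ge> 1"
    using C(1) by simp
  ultimately show thesis using that by blast
qed

text \<open>
  The points of the quarter ellipse form a decreasing chain, so it meets at most \<open>2 (M div L) + 1\<close> of the
  boxes of side \<open>L\<close>. Choose one point in each of them. Any other point is determined by its
  difference vector to the chosen point of its box, since no two parallel chords of equal length
  join points of a strictly convex decreasing arc.
\<close>

lemma card_lattice_points_ellipse:
  fixes S :: "(nat \<times> nat) set" and \<alpha> \<beta> \<gamma> :: int
  assumes "\<alpha> > 0" "\<beta> > 0" "L > 0"
    and S: "S \<subseteq> {..M} \<times> {..M}"
    and ell: "\<And>z y. (z, y) \<in> S \<Longrightarrow> \<alpha> * int z ^ 2 + \<beta> * int y ^ 2 = \<gamma>"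
  shows "card S \<le> 2 * (M div L) + 1 + (2 * L + 1) ^ 2"
proof -
  have "finite S" using S finite_subset by blast
  have anti: "y' < y" if "(z, y) \<in> S" "(z', y') \<in> S" "z < z'" for z y z' y'
  proof (rule ccontr)
    assume "\<not> y' < y"
    then have "\<beta> * int y ^ 2 \<le> \<beta> * int y' ^ 2"
      using assms(2) by (intro mult_left_mono power_mono) auto
    moreover have "\<alpha> * int z ^ 2 < \<alpha> * int z' ^ 2"
      using assms(1) that(3) by (intro mult_strict_left_mono power_strict_mono) auto
    ultimately show False using ell[OF that(1)] ell[OF that(2)] by linarith
  qed
  have inj: "y = y'" if "(z, y) \<in> S" "(z, y') \<in> S" for z y y'
  proof -
    have "\<beta> * int y ^ 2 = \<beta> * int y' ^ 2"
      using ell[OF that(1)] ell[OF that(2)] by linarith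
    then show ?thesis using assms(2) by simp
  qed
  \<comment> \<open>Along a decreasing chain this difference is monotone, hence it identifies the box.\<close>
  define key :: "nat \<times> nat \<Rightarrow> int" where "key = (\<lambda>(z, y). int (z div L) - int (y div L))"
  have keyeq0: "z div L = z' div L \<and> y div L = y' div L"
    if "(z, y) \<in> S" "(z', y') \<in> S" "key (z, y) = key (z', y')" "z \<le> z'" for z y z' y'
  proof -
    have "y' \<le> y"
      using anti[OF that(1,2)] inj[OF that(1)] that(2,4) by (cases "z = z'") auto
    then have "z div L \<le> z' div L" "y' div L \<le> y div L"
      using that(4) by (auto intro: div_le_mono)
    then show ?thesis using that(3) unfolding key_def by auto
  qed
  have keyeq: "z div L = z' div L \<and> y div L = y' div L"
    if "(z, y) \<in> S" "(z', y') \<in> S" "key (z, y) = key (z', y')" for z y z' y'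
  proof (cases "z \<le> z'")
    case True
    then show ?thesis using keyeq0[OF that] by blast
  next
    case False
    then show ?thesis using keyeq0[OF that(2,1) that(3)[symmetric]] by simp
  qed
  have close: "\<bar>int z - int z'\<bar> \<le> int L" if "z div L = z' div L" for z z' :: nat
  proof -
    have "z = L * (z div L) + z mod L" "z' = L * (z div L) + z' mod L"
      using that by (metis mult_div_mod_eq)+
    moreover have "z mod L < L" "z' mod L < L" using assms(3) by auto
    ultimately show ?thesis by linarith
  qed
  define rep where "rep k = (SOME s. s \<in> S \<and> key s = k)" for k
  have rep: "rep (key s) \<in> S \<and> key (rep (key s)) = key s" if "s \<in> S" for s
    unfolding rep_def by (rule someI[where x = s]) (use that in auto)
  define R where "R = rep ` key ` S"
  have "key ` S \<subseteq> {- int (M div L)..int (M div L)}"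
  proof
    fix k assume "k \<in> key ` S"
    then obtain z y where "(z, y) \<in> S" "k = int (z div L) - int (y div L)"
      unfolding key_def by auto
    moreover from this have "z div L \<le> M div L" "y div L \<le> M div L"
      using S by (auto intro: div_le_mono)
    ultimately show "k \<in> {- int (M div L)..int (M div L)}" by auto
  qed
  then have "card (key ` S) \<le> card {- int (M div L)..int (M div L)}"
    by (intro card_mono) auto
  then have cR: "card R \<le> 2 * (M div L) + 1"
    unfolding R_def using card_image_le[of "key ` S" rep] \<open>finite S\<close> by auto
  define diff :: "nat \<times> nat \<Rightarrow> int \<times> int" where
    "diff s = (int (fst s) - int (fst (rep (key s))), int (snd s) - int (snd (rep (key s))))" for s
  have "inj_on diff (S - R)"
  proof (rule inj_onI, rule ccontr)
    fix s s' assume *: "s \<in> S - R" "s' \<in> S - R" "diff s = diff s'" "s \<noteq> s'"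
    obtain z y z' y' where s: "s = (z, y)" "s' = (z', y')" by fastforce
    obtain a b a' b' where r: "rep (key s) = (a, b)" "rep (key s') = (a', b')" by fastforce
    have S4: "(z, y) \<in> S" "(z', y') \<in> S" "(a, b) \<in> S" "(a', b') \<in> S"
      using * s r rep by force+
    have "s \<noteq> rep (key s)" "s' \<noteq> rep (key s')"
      using * unfolding R_def by auto
    then have ne: "(z, y) \<noteq> (a, b)" "(z, y) \<noteq> (z', y')"
      using s r *(4) by auto
    define p q where "p = int z - int a" and "q = int y - int b"
    have pq: "int z' - int a' = p" "int y' - int b' = q"
      using *(3) unfolding diff_def s r[unfolded s] p_def q_def by auto
    have a: "int a = int z - p" "int b = int y - q" "int a' = int z' - p" "int b' = int y' - q"
      using pq unfolding p_def q_def by auto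
    have "\<alpha> * (int z - p) ^ 2 + \<beta> * (int y - q) ^ 2 = \<alpha> * int z ^ 2 + \<beta> * int y ^ 2"
      using ell[OF S4(1)] ell[OF S4(3)] a by simp
    moreover have "\<alpha> * (int z' - p) ^ 2 + \<beta> * (int y' - q) ^ 2 = \<alpha> * int z' ^ 2 + \<beta> * int y' ^ 2"
      using ell[OF S4(2)] ell[OF S4(4)] a by simp
    \<comment> \<open>Subtracting the two chord equations cancels \<open>p^2\<close> and
      \<open>q^2\<close>: the common chord vector \<open>(p, q)\<close> is conjugate to the
      difference of the two points with respect to the quadratic form.\<close>
    ultimately have "2 * (\<alpha> * (p * (int z - int z')) + \<beta> * (q * (int y - int y'))) = 0"
      by (simp add: power2_eq_square algebra_simps)
    then have sum0: "\<alpha> * (p * (int z - int z')) + \<beta> * (q * (int y - int y')) = 0" by simp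
    \<comment> \<open>Both vectors have coordinates of opposite signs, because the arc is strictly
      decreasing. The two products then have the same sign, so the form cannot vanish.\<close>
    have pos: "\<alpha> * (f * g) + \<beta> * (h * l) \<noteq> 0"
      if "f > 0 \<and> h < 0 \<or> f < 0 \<and> h > 0" "g > 0 \<and> l < 0 \<or> g < 0 \<and> l > 0" for f g h l :: int
    proof -
      have "f * g > 0 \<and> h * l > 0 \<or> f * g < 0 \<and> h * l < 0"
        using that by (auto simp: mult_less_0_iff zero_less_mult_iff)
      then have "\<alpha> * (f * g) > 0 \<and> \<beta> * (h * l) > 0 \<or> \<alpha> * (f * g) < 0 \<and> \<beta> * (h * l) < 0"
        using assms(1,2) by (auto simp: mult_less_0_iff zero_less_mult_iff)
      then show ?thesis by linarith
    qed
    have "p > 0 \<and> q < 0 \<or> p < 0 \<and> q > 0"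
      using anti[OF S4(1,3)] anti[OF S4(3,1)] inj S4 ne unfolding p_def q_def
      by (cases z a rule: linorder_cases) auto
    moreover have "int z - int z' > 0 \<and> int y - int y' < 0 \<or> int z - int z' < 0 \<and> int y - int y' > 0"
      using anti[OF S4(1,2)] anti[OF S4(2,1)] inj S4 ne
      by (cases z z' rule: linorder_cases) auto
    ultimately show False using pos sum0 by blast
  qed
  moreover have "diff ` (S - R) \<subseteq> {- int L..int L} \<times> {- int L..int L}"
  proof
    fix w assume "w \<in> diff ` (S - R)"
    then obtain s where s: "s \<in> S" "w = diff s" by auto
    obtain z y where zy: "s = (z, y)" by fastforce
    obtain a b where r: "rep (key s) = (a, b)" by fastforce
    have "z div L = a div L \<and> y div L = b div L"
      using rep[OF s(1)] s(1) r zy by (intro keyeq) auto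
    then show "w \<in> {- int L..int L} \<times> {- int L..int L}"
      using close[of z a] close[of y b] unfolding s diff_def r unfolding zy by auto
  qed
  ultimately have "card (S - R) \<le> card ({- int L..int L} \<times> {- int L..int L})"
    by (intro card_inj_on_le) auto
  also have "\<dots> = (2 * L + 1) ^ 2"
  proof -
    have "nat (int L + 1 + int L) = 2 * L + 1" by simp
    then show ?thesis by (simp add: card_cartesian_product power2_eq_square)
  qed
  finally have "card (S - R) \<le> (2 * L + 1) ^ 2" .
  moreover have "card S \<le> card R + card (S - R)"
    using card_Un_le[of R "S - R"] card_mono[of "R \<union> (S - R)" S] \<open>finite S\<close>
    unfolding R_def by (auto intro: le_trans)
  ultimately show ?thesis using cR by linarith
qed

section \<open>Solutions with a large common divisor\<close>

definition quartic :: "nat \<Rightarrow> nat \<Rightarrow> nat" where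
  "quartic x y = x * y * (x\<^sup>2 + y\<^sup>2)"

text \<open>\<open>m\<close> divides \<open>gcd (n * m) (n * u) = n * gcd m u\<close>. This trades a
  factor \<open>u\<close> for a multiple of \<open>gcd m u\<close>, one factor at a time.\<close>

lemma dvd_mult_gcd_bound:
  fixes m n u B :: int
  assumes "m dvd n * u" "gcd m u dvd B"
  shows "m dvd n * B"
proof -
  have "m dvd gcd (n * m) (n * u)"
    using assms(1) by simp
  then have "m dvd \<bar>n * gcd m u\<bar>"
    by (simp add: gcd_mult_left abs_mult)
  then have "m dvd n * gcd m u" by simp
  then show ?thesis
    using assms(2) by (meson dvd_trans mult_dvd_mono dvd_refl)
qed

lemma cubic_relation:
  fixes h k a b u v :: int
  assumes "h * a * (k * u) * ((h * a)\<^sup>2 + (k * u)\<^sup>2) = h * b * (k * v) * ((h * b)\<^sup>2 + (k * v)\<^sup>2)"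
    and "h \<noteq> 0" "k \<noteq> 0"
  shows "k\<^sup>2 * (a * u ^ 3 - b * v ^ 3) = h\<^sup>2 * (b ^ 3 * v - a ^ 3 * u)"
proof -
  have "h * k * (k\<^sup>2 * (a * u ^ 3 - b * v ^ 3) - h\<^sup>2 * (b ^ 3 * v - a ^ 3 * u)) = 0"
    using assms(1) by (simp add: algebra_simps power2_eq_square power3_eq_cube)
  then show ?thesis using assms(2,3) by simp
qed

text \<open>The point is a multiple of \<open>m = b^3 v - a^3 u\<close> that is free of
  \<open>h\<close>, \<open>u\<close> and \<open>v\<close>, so that few \<open>m\<close> belong to
  given \<open>k\<close>, \<open>a\<close>, \<open>b\<close>. Multiplying by \<open>b^9\<close>
  eliminates \<open>v\<close> and leaves a factor \<open>u^3\<close>. A common divisor of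
  \<open>m\<close> and \<open>u\<close> divides \<open>b^3 v\<close> and is coprime to
  \<open>v\<close>, so \<open>gcd m u\<close> divides \<open>b^3\<close>, and each of the three
  factors \<open>u\<close> can be replaced by \<open>b^3\<close>.\<close>

lemma cubic_relation_dvd:
  fixes h k a b u v :: int
  assumes eq: "k\<^sup>2 * (a * u ^ 3 - b * v ^ 3) = h\<^sup>2 * (b ^ 3 * v - a ^ 3 * u)"
    and "coprime u v"
  shows "b ^ 3 * v - a ^ 3 * u dvd k\<^sup>2 * a * b ^ 10 * (b ^ 8 - a ^ 8)"
proof -
  define m where "m = b ^ 3 * v - a ^ 3 * u"
  \<comment> \<open>Modulo \<open>m\<close> one may replace \<open>b\<^sup>3 v\<close> by \<open>a\<^sup>3 u\<close>, which eliminates \<open>v\<close>.\<close>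
  have "b ^ 9 * (a * u ^ 3 - b * v ^ 3) = a * b * (b ^ 8 - a ^ 8) * u ^ 3
      - m * (b * ((b ^ 3 * v)\<^sup>2 + (b ^ 3 * v) * (a ^ 3 * u) + (a ^ 3 * u)\<^sup>2))"
    unfolding m_def by (simp add: algebra_simps power_numeral_reduce)
  then have "k\<^sup>2 * (a * b * (b ^ 8 - a ^ 8)) * u ^ 3
      = b ^ 9 * (h\<^sup>2 * m) + k\<^sup>2 * (m * (b * ((b ^ 3 * v)\<^sup>2 + (b ^ 3 * v) * (a ^ 3 * u) + (a ^ 3 * u)\<^sup>2)))"
    using eq[folded m_def] by algebra
  then have "m dvd k\<^sup>2 * (a * b * (b ^ 8 - a ^ 8)) * u ^ 3"
    by simp
  then have "m dvd k\<^sup>2 * (a * b * (b ^ 8 - a ^ 8)) * u * u * u"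
    by (simp add: power3_eq_cube mult_ac)
  moreover have "gcd m u dvd b ^ 3"
  proof -
    have "gcd m u dvd m + a ^ 3 * u" by (intro dvd_add) auto
    then have "gcd m u dvd b ^ 3 * v" unfolding m_def by simp
    moreover have "coprime (gcd m u) v"
      using assms(2) by (meson coprime_divisors dvd_refl gcd_dvd2)
    ultimately show ?thesis by (simp add: coprime_dvd_mult_left_iff)
  qed
  ultimately have "m dvd k\<^sup>2 * (a * b * (b ^ 8 - a ^ 8)) * u * u * b ^ 3"
    using dvd_mult_gcd_bound by blast
  then have "m dvd k\<^sup>2 * (a * b * (b ^ 8 - a ^ 8)) * b ^ 3 * u * u"
    by (simp add: mult_ac)
  with \<open>gcd m u dvd b ^ 3\<close> have "m dvd k\<^sup>2 * (a * b * (b ^ 8 - a ^ 8)) * b ^ 3 * u * b ^ 3"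
    using dvd_mult_gcd_bound by blast
  then have "m dvd k\<^sup>2 * (a * b * (b ^ 8 - a ^ 8)) * b ^ 3 * b ^ 3 * u"
    by (simp add: mult_ac)
  with \<open>gcd m u dvd b ^ 3\<close> have "m dvd k\<^sup>2 * (a * b * (b ^ 8 - a ^ 8)) * b ^ 3 * b ^ 3 * b ^ 3"
    using dvd_mult_gcd_bound by blast
  also have "\<dots> = k\<^sup>2 * a * b ^ 10 * (b ^ 8 - a ^ 8)"
    by (simp add: algebra_simps power_numeral_reduce)
  finally show ?thesis unfolding m_def .
qed

text \<open>If \<open>b^3 v = a^3 u\<close>, the other bracket vanishes too. Multiplying the two
  equations gives \<open>(b v)^4 = (a u)^4\<close>, hence \<open>b v = a u\<close>, then
  \<open>u = v\<close> and \<open>a = b\<close>. Nonvanishing is what later allows \<open>h\<close>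
  to be recovered from \<open>h^2 m\<close>.\<close>

lemma cubic_relation_nonzero:
  fixes h k a b u v :: int
  assumes eq: "k\<^sup>2 * (a * u ^ 3 - b * v ^ 3) = h\<^sup>2 * (b ^ 3 * v - a ^ 3 * u)"
    and pos: "k > 0" "a > 0" "b > 0" "u > 0" "v > 0" and "a \<noteq> b"
  shows "b ^ 3 * v \<noteq> a ^ 3 * u"
proof
  assume *: "b ^ 3 * v = a ^ 3 * u"
  then have "a * u ^ 3 = b * v ^ 3" using eq pos by simp
  have "b ^ 3 * v * (b * v ^ 3) = a ^ 3 * u * (a * u ^ 3)"
    using * \<open>a * u ^ 3 = b * v ^ 3\<close> by simp
  then have "(b * v) ^ 4 = (a * u) ^ 4"
    by (simp add: algebra_simps power_numeral_reduce)
  then have "b * v = a * u"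
    using pos by (auto dest: power_eq_imp_eq_base)
  have "a * u * u\<^sup>2 = b * v * v\<^sup>2"
    using \<open>a * u ^ 3 = b * v ^ 3\<close> by (simp add: algebra_simps power_numeral_reduce)
  then have "u\<^sup>2 = v\<^sup>2" using \<open>b * v = a * u\<close> pos by simp
  then have "u = v" using pos by (simp add: power2_eq_iff_nonneg)
  then show False using \<open>b * v = a * u\<close> \<open>a \<noteq> b\<close> pos by simp
qed

text \<open>Only the pairing of \<open>x\<close> with \<open>z\<close> and \<open>y\<close> with
  \<open>w\<close> is recorded; the other pairings arise by swapping coordinates, since
  \<open>quartic\<close> is symmetric. The last inequality gives \<open>k <= h\<close>, so
  \<open>h a <= M\<close> also bounds \<open>a\<close> by \<open>M / k\<close>; the condition that
  \<open>x\<close> and \<open>z\<close> differ gives distinct \<open>a\<close> and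
  \<open>b\<close>.\<close>

definition large_gcd_solutions :: "nat \<Rightarrow> nat \<Rightarrow> (nat \<times> nat \<times> nat \<times> nat) set" where
  "large_gcd_solutions H M = {(x, y, z, w). {x, y, z, w} \<subseteq> {1..M} \<and> quartic x y = quartic z w
     \<and> x \<noteq> z \<and> H \<le> gcd x z \<and> gcd y w \<le> gcd x z}"

lemma large_gcd_solutions_params:
  assumes "(x, y, z, w) \<in> large_gcd_solutions H M"
  obtains h k a b u v :: nat and m :: int where
    "x = h * a" "y = k * u" "z = h * b" "w = k * v" "h = gcd x z" "k = gcd y w"
    "h > 0" "k > 0" "a > 0" "b > 0" "u > 0" "v > 0" "a \<noteq> b" "coprime a b" "coprime u v"
    "m = int b ^ 3 * int v - int a ^ 3 * int u" "m \<noteq> 0"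
    "m dvd int k ^ 2 * int a * int b ^ 10 * (int b ^ 8 - int a ^ 8)"
    "int k ^ 2 * (int a * int u ^ 3 - int b * int v ^ 3) = int h ^ 2 * m"
proof -
  have pos: "x > 0" "y > 0" "z > 0" "w > 0" and "x \<noteq> z" and Q: "quartic x y = quartic z w"
    using assms unfolding large_gcd_solutions_def by auto
  define h k where "h = gcd x z" and "k = gcd y w"
  have "h > 0" "k > 0" using pos unfolding h_def k_def by auto
  obtain a b where ab: "x = h * a" "z = h * b" "coprime a b"
    using gcd_coprime_exists[of x z] \<open>h > 0\<close> unfolding h_def by (auto simp: mult.commute)
  obtain u v where uv: "y = k * u" "w = k * v" "coprime u v"
    using gcd_coprime_exists[of y w] \<open>k > 0\<close> unfolding k_def by (auto simp: mult.commute)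
  have pos': "a > 0" "b > 0" "u > 0" "v > 0" "a \<noteq> b"
    using pos ab uv \<open>x \<noteq> z\<close> by auto
  have "int (quartic x y) = int (quartic z w)" using Q by simp
  then have rel: "int k ^ 2 * (int a * int u ^ 3 - int b * int v ^ 3)
      = int h ^ 2 * (int b ^ 3 * int v - int a ^ 3 * int u)"
    using \<open>h > 0\<close> \<open>k > 0\<close> unfolding quartic_def ab uv
    by (intro cubic_relation) (simp_all add: mult.assoc)
  show thesis
  proof (rule that[of h a k u b v])
    show "int b ^ 3 * int v - int a ^ 3 * int u \<noteq> 0"
      using cubic_relation_nonzero[OF rel] pos' \<open>k > 0\<close> by simp
    show "int b ^ 3 * int v - int a ^ 3 * int u
        dvd int k ^ 2 * int a * int b ^ 10 * (int b ^ 8 - int a ^ 8)"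
      using cubic_relation_dvd[OF rel] uv(3) by simp
  qed (rule ab uv pos' rel h_def k_def refl \<open>h > 0\<close> \<open>k > 0\<close>)+
qed

lemma card_divisors_int_le:
  fixes n :: int
  assumes "n \<noteq> 0"
  shows "card {m. m dvd n} \<le> 2 * tau (nat \<bar>n\<bar>)" and "finite {m. m dvd n}"
proof -
  let ?D = "{d. d dvd nat \<bar>n\<bar>}"
  have fin: "finite ?D" using assms by (intro finite_divisors_nat) simp
  have sub: "{m. m dvd n} \<subseteq> int ` ?D \<union> (\<lambda>d. - int d) ` ?D"
  proof
    fix m assume "m \<in> {m. m dvd n}"
    then have "nat \<bar>m\<bar> \<in> ?D" by (simp add: nat_abs_dvd_iff)
    moreover have "m = int (nat \<bar>m\<bar>) \<or> m = - int (nat \<bar>m\<bar>)" by linarith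
    ultimately show "m \<in> int ` ?D \<union> (\<lambda>d. - int d) ` ?D" by blast
  qed
  show "finite {m. m dvd n}" using sub fin finite_subset by blast
  have "card {m. m dvd n} \<le> card (int ` ?D \<union> (\<lambda>d. - int d) ` ?D)"
    using sub fin by (intro card_mono) auto
  also have "\<dots> \<le> card (int ` ?D) + card ((\<lambda>d. - int d) ` ?D)"
    by (rule card_Un_le)
  also have "\<dots> \<le> card ?D + card ?D"
    using fin by (intro add_mono card_image_le)
  finally show "card {m. m dvd n} \<le> 2 * tau (nat \<bar>n\<bar>)" by simp
qed

lemma sum_inverse_cubes_le: "(\<Sum>a = 1..n. 1 / real a ^ 3) \<le> 2"
proof -
  \<comment> \<open>The sharper bound is the one that passes through the induction: for
    \<open>a >= 2\<close>, \<open>1 / a^3 <= 1 / (a (a + 1))\<close>, which telescopes.\<close>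
  have "(\<Sum>a = 1..n. 1 / real a ^ 3) \<le> 2 - 1 / (real n + 1)"
  proof (induction n)
    case (Suc n)
    show ?case
    proof (cases "n = 0")
      case False
      have "1 / real (Suc n) ^ 3 \<le> 1 / (real (Suc n) * real (Suc n + 1))"
      proof (rule divide_left_mono)
        have "real (Suc n + 1) \<le> real (Suc n) * real (Suc n)"
          using False by (simp add: algebra_simps add_increasing2)
        then show "real (Suc n) * real (Suc n + 1) \<le> real (Suc n) ^ 3"
          unfolding power3_eq_cube by (simp only: mult.assoc) (rule mult_left_mono, auto)
      qed auto
      also have "\<dots> = 1 / real (Suc n) - 1 / (real (Suc n) + 1)"
        by (simp add: field_simps)
      finally show ?thesis using Suc by (simp add: add_ac)
    qed auto
  qed simp
  also have "\<dots> \<le> 2" by simp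
  finally show ?thesis .
qed

text \<open>
  Given \<open>k\<close>, \<open>a\<close>, \<open>b\<close> and the divisor \<open>m = b\<^sup>3 v - a\<^sup>3 u\<close>, the residue of \<open>v\<close> modulo \<open>a\<^sup>3\<close> is determined, so
  that \<open>v div a\<^sup>3\<close> determines \<open>v\<close>, then \<open>u\<close>, and finally \<open>h\<close>.
\<close>

proposition card_large_gcd_solutions_le:
  assumes "H > 0" and T: "\<And>n. 0 < n \<Longrightarrow> n \<le> M ^ 21 \<Longrightarrow> tau n \<le> T"
  shows "real (card (large_gcd_solutions H M)) \<le> 6 * real T * real M ^ 2 / real H * (\<Sum>k = 1..M. 1 / real k)"
proof -
  \<comment> \<open>\<open>h a\<close> and \<open>h b\<close> are at most \<open>M\<close>, while
    \<open>h >= k\<close> and \<open>h >= H\<close>; so \<open>A k\<close> bounds both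
    \<open>a\<close> and \<open>b\<close>.\<close>
  define A where "A k = min (M div k) (M div H)" for k
  define n where "n k a b = int k ^ 2 * int a * int b ^ 10 * (int b ^ 8 - int a ^ 8)" for k a b
  \<comment> \<open>The last coordinate is the range of \<open>v div a ^ 3\<close>, since
    \<open>k v <= M\<close>.\<close>
  define W where "W = (SIGMA k:{1..M}. SIGMA a:{1..A k}. SIGMA b:{1..A k} - {a}.
    {m. m dvd n k a b} \<times> {..M div (k * a ^ 3)})"
  define f :: "nat \<times> nat \<times> nat \<times> nat \<Rightarrow> nat \<times> nat \<times> nat \<times> int \<times> nat" where
    "f = (\<lambda>(x, y, z, w). let h = gcd x z; k = gcd y w; a = x div h; b = z div h; u = y div k; v = w div k
       in (k, a, b, int b ^ 3 * int v - int a ^ 3 * int u, v div a ^ 3))"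
  have f_eq: "f (x, y, z, w) = (k, a, b, m, v div a ^ 3)"
    if "x = h * a" "y = k * u" "z = h * b" "w = k * v" "h = gcd x z" "k = gcd y w" "h > 0" "k > 0"
      "m = int b ^ 3 * int v - int a ^ 3 * int u" for x y z w h k a b u v m
  proof -
    have "x div h = a" "y div k = u" "z div h = b" "w div k = v"
      using that(1-4,7,8) by auto
    then show ?thesis
      by (simp add: f_def that(5)[symmetric] that(6)[symmetric] that(9))
  qed
  have "f ` large_gcd_solutions H M \<subseteq> W"
  proof
    fix s assume "s \<in> f ` large_gcd_solutions H M"
    then obtain x y z w where p: "(x, y, z, w) \<in> large_gcd_solutions H M" and s: "s = f (x, y, z, w)"
      by auto
    obtain h k a b u v :: nat and m :: int where P:
      "x = h * a" "y = k * u" "z = h * b" "w = k * v" "h = gcd x z" "k = gcd y w"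
      "h > 0" "k > 0" "a > 0" "b > 0" "u > 0" "v > 0" "a \<noteq> b" "coprime a b" "coprime u v"
      "m = int b ^ 3 * int v - int a ^ 3 * int u" "m \<noteq> 0" "m dvd n k a b"
      "int k ^ 2 * (int a * int u ^ 3 - int b * int v ^ 3) = int h ^ 2 * m"
      unfolding n_def by (rule large_gcd_solutions_params[OF p]) blast
    have s': "s = (k, a, b, m, v div a ^ 3)"
      unfolding s by (rule f_eq[OF P(1-8,16)])
    have le: "h * a \<le> M" "h * b \<le> M" "k * v \<le> M" "H \<le> h" "k \<le> h"
    proof -
      have "x \<le> M" "z \<le> M" "w \<le> M" "H \<le> gcd x z" "gcd y w \<le> gcd x z"
        using p unfolding large_gcd_solutions_def by auto
      then show "h * a \<le> M" "h * b \<le> M" "k * v \<le> M" "H \<le> h" "k \<le> h"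
        by (simp_all only: P(1,3,4)[symmetric] P(5,6)[symmetric])
    qed
    have "H * a \<le> M" "H * b \<le> M" "k * a \<le> M" "k * b \<le> M"
      by (rule order_trans[OF mult_le_mono1 le(1)] order_trans[OF mult_le_mono1 le(2)], rule le(4,5))+
    then have ab: "a \<le> A k" "b \<le> A k"
      unfolding A_def using \<open>k > 0\<close> \<open>H > 0\<close> by (simp_all add: less_eq_div_iff_mult_less_eq mult.commute)
    have "k \<le> k * v" using P(12) by simp
    then have "k \<le> M" using le by linarith
    have "v div a ^ 3 \<le> (M div k) div a ^ 3"
      using le(3) \<open>k > 0\<close> by (intro div_le_mono) (simp add: less_eq_div_iff_mult_less_eq mult.commute)
    then have "v div a ^ 3 \<le> M div (k * a ^ 3)" by (simp add: div_mult2_eq)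
    then show "s \<in> W" unfolding s' W_def using P(8,9,10,13,18) ab \<open>k \<le> M\<close> by auto
  qed
  moreover have "inj_on f (large_gcd_solutions H M)"
  proof (rule inj_onI)
    fix s s' assume ss: "s \<in> large_gcd_solutions H M" "s' \<in> large_gcd_solutions H M" "f s = f s'"
    obtain x y z w x' y' z' w' where s: "s = (x, y, z, w)" "s' = (x', y', z', w')"
      by (cases s, cases s') auto
    have p: "(x, y, z, w) \<in> large_gcd_solutions H M" and p': "(x', y', z', w') \<in> large_gcd_solutions H M"
      and ff: "f (x, y, z, w) = f (x', y', z', w')"
      using ss unfolding s by auto
    obtain h k a b u v :: nat and m :: int where P:
      "x = h * a" "y = k * u" "z = h * b" "w = k * v" "h = gcd x z" "k = gcd y w"
      "h > 0" "k > 0" "a > 0" "b > 0" "u > 0" "v > 0" "a \<noteq> b" "coprime a b" "coprime u v"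
      "m = int b ^ 3 * int v - int a ^ 3 * int u" "m \<noteq> 0" "m dvd n k a b"
      "int k ^ 2 * (int a * int u ^ 3 - int b * int v ^ 3) = int h ^ 2 * m"
      unfolding n_def by (rule large_gcd_solutions_params[OF p]) blast
    obtain h' k' a' b' u' v' :: nat and m' :: int where P':
      "x' = h' * a'" "y' = k' * u'" "z' = h' * b'" "w' = k' * v'" "h' = gcd x' z'" "k' = gcd y' w'"
      "h' > 0" "k' > 0" "a' > 0" "b' > 0" "u' > 0" "v' > 0" "a' \<noteq> b'" "coprime a' b'" "coprime u' v'"
      "m' = int b' ^ 3 * int v' - int a' ^ 3 * int u'" "m' \<noteq> 0" "m' dvd n k' a' b'"
      "int k' ^ 2 * (int a' * int u' ^ 3 - int b' * int v' ^ 3) = int h' ^ 2 * m'"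
      unfolding n_def by (rule large_gcd_solutions_params[OF p']) blast
    have "f (x, y, z, w) = (k, a, b, m, v div a ^ 3)"
      by (rule f_eq[OF P(1-8,16)])
    moreover have "f (x', y', z', w') = (k', a', b', m', v' div a' ^ 3)"
      by (rule f_eq[OF P'(1-8,16)])
    ultimately have eqs: "k' = k" "a' = a" "b' = b" "m' = m" "v' div a ^ 3 = v div a ^ 3"
      using ff by auto
    have uv: "int b ^ 3 * (int v - int v') = int a ^ 3 * (int u - int u')"
      using P(16) P'(16) eqs by (simp add: algebra_simps)
    then have "int a ^ 3 dvd int b ^ 3 * (int v - int v')" by simp
    moreover have "coprime (int a ^ 3) (int b ^ 3)" using P(14) by simp
    ultimately have "int (a ^ 3) dvd int v - int v'"
      by (simp add: coprime_dvd_mult_right_iff)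
    then have "int v mod int (a ^ 3) = int v' mod int (a ^ 3)"
      by (simp add: mod_eq_dvd_iff)
    then have "v mod a ^ 3 = v' mod a ^ 3"
      by (metis of_nat_eq_iff of_nat_mod)
    then have "v = v'" using eqs(5) by (metis mult_div_mod_eq)
    then have "u = u'" using uv P(9) by simp
    have "int h ^ 2 * m = int h' ^ 2 * m"
      using P(19) P'(19) eqs \<open>u = u'\<close> \<open>v = v'\<close> by simp
    then have "h = h'" using P(17) by (simp add: power2_eq_iff_nonneg)
    show "s = s'"
      unfolding s using P(1-4) P'(1-4) eqs \<open>h = h'\<close> \<open>u = u'\<close> \<open>v = v'\<close> by simp
  qed
  moreover have n0: "n k a b \<noteq> 0" and nle: "nat \<bar>n k a b\<bar> \<le> M ^ 21"
    if "k \<in> {1..M}" "a \<in> {1..A k}" "b \<in> {1..A k} - {a}" for k a b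
  proof -
    have "A k \<le> M" unfolding A_def by (simp add: min.coboundedI1)
    then have le: "1 \<le> k" "k \<le> M" "1 \<le> a" "a \<le> M" "1 \<le> b" "b \<le> M" "a \<noteq> b"
      using that by auto
    have "int b ^ 8 \<noteq> int a ^ 8"
      using le by (auto dest: power_eq_imp_eq_base)
    then show "n k a b \<noteq> 0" unfolding n_def using le by simp
    have "int a ^ 8 \<le> int M ^ 8" "int b ^ 8 \<le> int M ^ 8"
      using le by (auto intro: power_mono)
    then have "\<bar>int b ^ 8 - int a ^ 8\<bar> \<le> int M ^ 8"
      by (smt (verit) zero_le_power of_nat_0_le_iff)
    \<comment> \<open>The exponent 21 is \<open>2 + 1 + 10 + 8\<close>, from the factors
      \<open>k^2\<close>, \<open>a\<close>, \<open>b^10\<close> and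
      \<open>b^8 - a^8\<close>.\<close>
    then have "\<bar>n k a b\<bar> \<le> int M ^ 2 * int M * int M ^ 10 * int M ^ 8"
      unfolding n_def abs_mult power_abs using le
      by (intro mult_mono power_mono) auto
    also have "\<dots> = int (M ^ 21)" by (simp flip: power_add power_Suc power_Suc2)
    finally show "nat \<bar>n k a b\<bar> \<le> M ^ 21" by linarith
  qed
  moreover have cm: "card {m. m dvd n k a b} \<le> 2 * T"
    if "k \<in> {1..M}" "a \<in> {1..A k}" "b \<in> {1..A k} - {a}" for k a b
    using card_divisors_int_le(1)[OF n0[OF that]] T[OF _ nle[OF that]] n0[OF that] by force
  have finW: "finite W"
    unfolding W_def by (intro finite_SigmaI finite_cartesian_product card_divisors_int_le(2) n0) auto
  ultimately have "card (large_gcd_solutions H M) \<le> card W"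
    by (intro card_inj_on_le)
  also have "\<dots> = (\<Sum>k = 1..M. \<Sum>a = 1..A k. \<Sum>b\<in>{1..A k} - {a}. card {m. m dvd n k a b} * (M div (k * a ^ 3) + 1))"
  proof -
    have fin3: "finite ({m. m dvd n k a b} \<times> {..M div (k * a ^ 3)})"
      if "k \<in> {1..M}" "a \<in> {1..A k}" "b \<in> {1..A k} - {a}" for k a b
      using card_divisors_int_le(2)[OF n0[OF that]] by simp
    have fin2: "finite (SIGMA b:{1..A k} - {a}. {m. m dvd n k a b} \<times> {..M div (k * a ^ 3)})"
      if "k \<in> {1..M}" "a \<in> {1..A k}" for k a
      by (rule finite_SigmaI[OF _ fin3[OF that]]) auto
    have fin1: "finite (SIGMA a:{1..A k}. SIGMA b:{1..A k} - {a}. {m. m dvd n k a b} \<times> {..M div (k * a ^ 3)})"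
      if "k \<in> {1..M}" for k
      by (rule finite_SigmaI[OF _ fin2[OF that]]) auto
    have "card W = (\<Sum>k = 1..M. card (SIGMA a:{1..A k}. SIGMA b:{1..A k} - {a}.
        {m. m dvd n k a b} \<times> {..M div (k * a ^ 3)}))"
      unfolding W_def by (rule card_SigmaI) (use fin1 in blast)+
    also have "\<dots> = (\<Sum>k = 1..M. \<Sum>a = 1..A k. card (SIGMA b:{1..A k} - {a}.
        {m. m dvd n k a b} \<times> {..M div (k * a ^ 3)}))"
      by (intro sum.cong refl card_SigmaI ballI fin2) simp_all
    also have "\<dots> = (\<Sum>k = 1..M. \<Sum>a = 1..A k. \<Sum>b\<in>{1..A k} - {a}.
        card ({m. m dvd n k a b} \<times> {..M div (k * a ^ 3)}))"
      by (intro sum.cong refl card_SigmaI ballI fin3) simp_all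
    finally show ?thesis by (simp add: card_cartesian_product)
  qed
  finally have "real (card (large_gcd_solutions H M)) \<le> real
    (\<Sum>k = 1..M. \<Sum>a = 1..A k. \<Sum>b\<in>{1..A k} - {a}. card {m. m dvd n k a b} * (M div (k * a ^ 3) + 1))"
    by (rule of_nat_mono)
  then have "real (card (large_gcd_solutions H M)) \<le>
    (\<Sum>k = 1..M. \<Sum>a = 1..A k. \<Sum>b\<in>{1..A k} - {a}. real (card {m. m dvd n k a b} * (M div (k * a ^ 3) + 1)))"
    by (simp only: of_nat_sum)
  also have "\<dots> \<le> (\<Sum>k = 1..M. \<Sum>a = 1..A k. \<Sum>b\<in>{1..A k} - {a}. real (2 * T) * (real M / real k * (1 / real a ^ 3) + 1))"
  proof (intro sum_mono)
    fix k a b assume kab: "k \<in> {1..M}" "a \<in> {1..A k}" "b \<in> {1..A k} - {a}"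
    have "real (M div (k * a ^ 3)) \<le> real M / real (k * a ^ 3)"
      by (rule of_nat_div_le_of_nat)
    then have "real (card {m. m dvd n k a b}) * (real (M div (k * a ^ 3)) + 1) \<le> real (2 * T) * (real M / real k * (1 / real a ^ 3) + 1)"
      using cm[OF kab] by (intro mult_mono of_nat_mono add_right_mono) (simp_all add: field_simps)
    then show "real (card {m. m dvd n k a b} * (M div (k * a ^ 3) + 1)) \<le> real (2 * T) * (real M / real k * (1 / real a ^ 3) + 1)"
      by (simp only: of_nat_mult of_nat_add of_nat_1)
  qed
  also have "\<dots> \<le> (\<Sum>k = 1..M. 6 * real T * real M ^ 2 / real H * (1 / real k))"
  proof (intro sum_mono)
    fix k assume k: "k \<in> {1..M}"
    have A: "real (A k) \<le> real M / real k" "real (A k) \<le> real M / real H"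
      unfolding A_def using of_nat_div_le_of_nat[of M k, where ?'a = real] of_nat_div_le_of_nat[of M H, where ?'a = real] by (auto simp: min_def)
    have "(\<Sum>a = 1..A k. \<Sum>b\<in>{1..A k} - {a}. real (2 * T) * (real M / real k * (1 / real a ^ 3) + 1))
        \<le> (\<Sum>a = 1..A k. real (A k) * (real (2 * T) * (real M / real k * (1 / real a ^ 3) + 1)))"
    proof (rule sum_mono)
      fix a assume "a \<in> {1..A k}"
      have "card ({1..A k} - {a}) \<le> A k"
        using card_Diff1_le[of "{1..A k}" a] by simp
      then show "(\<Sum>b\<in>{1..A k} - {a}. real (2 * T) * (real M / real k * (1 / real a ^ 3) + 1))
        \<le> real (A k) * (real (2 * T) * (real M / real k * (1 / real a ^ 3) + 1))"
        by (simp only: sum_constant) (intro mult_right_mono, auto)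
    qed
    also have "\<dots> = real (A k) * real (2 * T) * (real M / real k * (\<Sum>a = 1..A k. 1 / real a ^ 3) + real (A k))"
      by (simp add: sum_distrib_left sum.distrib algebra_simps)
    \<comment> \<open>The outer \<open>A k\<close> is bounded by \<open>M / H\<close>, which
      supplies the saving, and the inner one by \<open>M / k\<close>, which matches the other
      summand.\<close>
    also have "\<dots> \<le> real M / real H * real (2 * T) * (real M / real k * 2 + real M / real k)"
    proof (intro mult_mono add_mono)
      show "0 \<le> real M / real k * (\<Sum>a = 1..A k. 1 / real a ^ 3) + real (A k)"
        by (intro add_nonneg_nonneg mult_nonneg_nonneg sum_nonneg) auto
    qed (use A sum_inverse_cubes_le[of "A k"] in \<open>simp_all add: sum_nonneg\<close>)
    also have "\<dots> = 6 * real T * real M ^ 2 / real H * (1 / real k)"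
    proof -
      have "p / q * (2 * t) * (p / r * 2 + p / r) = 6 * t * p ^ 2 / q * (1 / r)" for p q r t :: real
        by (simp add: power2_eq_square divide_inverse algebra_simps)
      then show ?thesis by (simp only: of_nat_mult of_nat_numeral)
    qed
    finally show "(\<Sum>a = 1..A k. \<Sum>b\<in>{1..A k} - {a}. real (2 * T) * (real M / real k * (1 / real a ^ 3) + 1))
        \<le> 6 * real T * real M ^ 2 / real H * (1 / real k)" .
  qed
  finally show ?thesis by (simp only: sum_distrib_left)
qed

section \<open>Counting all solutions\<close>

definition small_gcd_solutions :: "nat \<Rightarrow> nat \<Rightarrow> nat \<Rightarrow> (nat \<times> nat \<times> nat \<times> nat) set" where
  "small_gcd_solutions H Y M = {(x, y, z, w). {x, y, z, w} \<subseteq> {1..M} \<and> quartic x y = quartic z w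
     \<and> x < y \<and> z < w \<and> Y \<le> z \<and> gcd x z < H \<and> gcd x w < H \<and> gcd y z < H \<and> gcd y w < H}"

lemma gcd_mult_dvd_mult_gcd:
  fixes k m n :: nat
  shows "gcd k (m * n) dvd gcd k m * gcd k n"
proof -
  obtain b c where "gcd k (m * n) = b * c" "b dvd m" "c dvd n"
    using division_decomp[of "gcd k (m * n)" m n] by auto
  moreover from this have "b dvd k" "c dvd k"
    by (metis dvd_mult_left dvd_mult_right gcd_dvd1)+
  ultimately show ?thesis by (auto intro: mult_dvd_mono)
qed

text \<open>Take \<open>g = gcd (x y) (z w)\<close> and write \<open>x y = g a\<close>,
  \<open>z w = g b\<close>. The equation becomes \<open>a (x^2 + y^2) = b (z^2 + w^2)\<close> with
  \<open>a\<close>, \<open>b\<close> coprime, and \<open>t\<close> is the common quotient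
  \<open>(x^2 + y^2) / b = (z^2 + w^2) / a\<close>. Here \<open>g\<close> is at most the product of
  the four small gcds, and \<open>Y <= z\<close> keeps \<open>z w\<close> large, so
  \<open>t Y^2 <= t z w = g (x^2 + y^2)\<close> bounds \<open>t\<close>.\<close>

lemma small_gcd_solutions_params:
  assumes p: "(x, y, z, w) \<in> small_gcd_solutions H Y M" and "Y > 0" and B: "2 * H ^ 4 * M\<^sup>2 \<le> B * Y\<^sup>2"
  obtains g t :: nat where "g \<in> {1..H ^ 4}" "t \<in> {1..B}"
    "t * (x * y) = g * (z\<^sup>2 + w\<^sup>2)" "t * (z * w) = g * (x\<^sup>2 + y\<^sup>2)"
proof -
  have pos: "x > 0" "y > 0" "z > 0" "w > 0" and Q: "quartic x y = quartic z w"
    and gcds: "gcd x z < H" "gcd x w < H" "gcd y z < H" "gcd y w < H"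
    and le: "x \<le> M" "y \<le> M" "Y \<le> z" "Y \<le> w"
    using p unfolding small_gcd_solutions_def by auto
  define g where "g = gcd (x * y) (z * w)"
  have "g > 0" using pos unfolding g_def by simp
  obtain a b where ab: "x * y = g * a" "z * w = g * b" "coprime a b"
    using gcd_coprime_exists[of "x * y" "z * w"] \<open>g > 0\<close> unfolding g_def by (auto simp: mult.commute)
  have "a > 0" "b > 0" using ab pos by (metis mult_pos_pos mult_0_right gr0I less_numeral_extra(3))+
  have Q': "a * (x\<^sup>2 + y\<^sup>2) = b * (z\<^sup>2 + w\<^sup>2)"
    using Q \<open>g > 0\<close> unfolding quartic_def ab(1,2) by (simp add: mult.assoc)
  then have "b dvd a * (x\<^sup>2 + y\<^sup>2)" by simp
  then have "b dvd x\<^sup>2 + y\<^sup>2"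
    using ab(3) by (simp add: coprime_commute coprime_dvd_mult_right_iff)
  then obtain t where t: "x\<^sup>2 + y\<^sup>2 = b * t" by blast
  have t': "z\<^sup>2 + w\<^sup>2 = a * t"
    using Q' \<open>b > 0\<close> unfolding t by simp
  have "t > 0" using t pos by (intro gr0I) simp
  have eq2: "t * (z * w) = g * (x\<^sup>2 + y\<^sup>2)"
    unfolding ab t by simp
  have "g dvd gcd x (z * w) * gcd y (z * w)"
    unfolding g_def using gcd_mult_dvd_mult_gcd[of "z * w" x y] by (simp only: gcd.commute)
  also have "\<dots> dvd (gcd x z * gcd x w) * (gcd y z * gcd y w)"
    by (intro mult_dvd_mono gcd_mult_dvd_mult_gcd)
  finally have "g \<le> (gcd x z * gcd x w) * (gcd y z * gcd y w)"
    using pos by (intro dvd_imp_le) auto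
  also have "\<dots> \<le> (H * H) * (H * H)"
    using gcds by (intro mult_le_mono) auto
  finally have "g \<le> H ^ 4" by (simp add: power_numeral_reduce)
  have "t * Y\<^sup>2 \<le> t * (z * w)"
    unfolding power2_eq_square using le by (intro mult_le_mono) auto
  also have "\<dots> \<le> H ^ 4 * (M\<^sup>2 + M\<^sup>2)"
    unfolding eq2 using le \<open>g \<le> H ^ 4\<close> by (intro mult_le_mono add_mono power_mono) auto
  also have "\<dots> \<le> B * Y\<^sup>2" using B by (simp add: mult.assoc mult.left_commute flip: mult_2)
  finally have "t \<le> B" using \<open>Y > 0\<close> by simp
  show thesis
  proof (rule that[of g t])
    show "t * (x * y) = g * (z\<^sup>2 + w\<^sup>2)"
      unfolding ab t' by simp
  qed (use eq2 \<open>g > 0\<close> \<open>t > 0\<close> \<open>g \<le> H ^ 4\<close> \<open>t \<le> B\<close> in auto)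
qed

text \<open>Put \<open>X = x + y\<close>, \<open>Z = y - x\<close>, \<open>V = w - z\<close>.
  Eliminating \<open>w + z\<close> from the two relations for \<open>g\<close> and \<open>t\<close>
  places \<open>(Z, V)\<close> on an ellipse determined by \<open>g\<close>, \<open>t\<close> and
  \<open>X\<close>. The factors \<open>H ^ 4\<close>, \<open>B\<close> and \<open>2 * M\<close>
  count these three parameters; the last factor counts the lattice points.\<close>

lemma card_small_gcd_solutions_le:
  assumes "Y > 0" and "L > 0" and B: "2 * H ^ 4 * M\<^sup>2 \<le> B * Y\<^sup>2"
  shows "card (small_gcd_solutions H Y M)
    \<le> H ^ 4 * B * (2 * M) * (2 * (M div L) + 1 + (2 * L + 1) ^ 2)"
proof -
  define E where "E = (\<lambda>(g :: nat, t :: nat, X :: nat). {(Z, V) \<in> {..M} \<times> {..M}.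
    (int t ^ 2 + 4 * int g ^ 2) * int Z ^ 2 + (4 * int g * int t) * int V ^ 2
      = (int t ^ 2 - 4 * int g ^ 2) * int X ^ 2})"
  define J where "J = {1..H ^ 4} \<times> {1..B} \<times> {1..2 * M}"
  \<comment> \<open>Fixing one admissible pair \<open>(g, t)\<close> per solution makes it a
    function of the solution, so it can be a coordinate of the injection \<open>f\<close>.\<close>
  define par where "par = (\<lambda>(x, y, z, w). SOME (g, t). g \<in> {1..H ^ 4} \<and> t \<in> {1..B}
    \<and> t * (x * y) = g * (z\<^sup>2 + w\<^sup>2) \<and> t * (z * w) = g * (x\<^sup>2 + y\<^sup>2))"
  define f :: "nat \<times> nat \<times> nat \<times> nat \<Rightarrow> (nat \<times> nat \<times> nat) \<times> nat \<times> nat" where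
    "f = (\<lambda>(x, y, z, w). ((fst (par (x, y, z, w)), snd (par (x, y, z, w)), x + y), (y - x, w - z)))"
  have par: "g \<in> {1..H ^ 4} \<and> t \<in> {1..B} \<and> t * (x * y) = g * (z\<^sup>2 + w\<^sup>2) \<and> t * (z * w) = g * (x\<^sup>2 + y\<^sup>2)"
    if sol: "(x, y, z, w) \<in> small_gcd_solutions H Y M" and gt: "par (x, y, z, w) = (g, t)" for x y z w g t
  proof -
    obtain g0 t0 where "g0 \<in> {1..H ^ 4}" "t0 \<in> {1..B}"
      "t0 * (x * y) = g0 * (z\<^sup>2 + w\<^sup>2)" "t0 * (z * w) = g0 * (x\<^sup>2 + y\<^sup>2)"
      by (rule small_gcd_solutions_params[OF sol assms(1) B])
    then have "\<exists>p. (\<lambda>(g, t). g \<in> {1..H ^ 4} \<and> t \<in> {1..B}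
      \<and> t * (x * y) = g * (z\<^sup>2 + w\<^sup>2) \<and> t * (z * w) = g * (x\<^sup>2 + y\<^sup>2)) p"
      by (intro exI[of _ "(g0, t0)"]) simp
    from someI_ex[OF this] show ?thesis
      using gt unfolding par_def by simp
  qed
  have key: "int t * ((int w + int z)\<^sup>2 - (int w - int z)\<^sup>2) = 2 * int g * ((int x + int y)\<^sup>2 + (int y - int x)\<^sup>2)"
    "int t * ((int x + int y)\<^sup>2 - (int y - int x)\<^sup>2) = 2 * int g * ((int w + int z)\<^sup>2 + (int w - int z)\<^sup>2)"
    if "t * (x * y) = g * (z\<^sup>2 + w\<^sup>2)" "t * (z * w) = g * (x\<^sup>2 + y\<^sup>2)" for t g x y z w :: nat
  proof -
    have "int (t * (x * y)) = int (g * (z\<^sup>2 + w\<^sup>2))" "int (t * (z * w)) = int (g * (x\<^sup>2 + y\<^sup>2))"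
      using that by simp_all
    then have "int t * (int x * int y) = int g * (int z ^ 2 + int w ^ 2)"
      "int t * (int z * int w) = int g * (int x ^ 2 + int y ^ 2)"
      by simp_all
    then show "int t * ((int w + int z)\<^sup>2 - (int w - int z)\<^sup>2) = 2 * int g * ((int x + int y)\<^sup>2 + (int y - int x)\<^sup>2)"
      "int t * ((int x + int y)\<^sup>2 - (int y - int x)\<^sup>2) = 2 * int g * ((int w + int z)\<^sup>2 + (int w - int z)\<^sup>2)"
      by algebra+
  qed
  have "f ` small_gcd_solutions H Y M \<subseteq> Sigma J E"
  proof
    fix s assume "s \<in> f ` small_gcd_solutions H Y M"
    then obtain x y z w where p: "(x, y, z, w) \<in> small_gcd_solutions H Y M" and s: "s = f (x, y, z, w)"
      by auto
    obtain g t where gt: "par (x, y, z, w) = (g, t)" by fastforce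
    have P: "g \<in> {1..H ^ 4}" "t \<in> {1..B}" "t * (x * y) = g * (z\<^sup>2 + w\<^sup>2)" "t * (z * w) = g * (x\<^sup>2 + y\<^sup>2)"
      using par[OF p gt] by auto
    have le: "1 \<le> x" "x < y" "y \<le> M" "z < w" "w \<le> M"
      using p unfolding small_gcd_solutions_def by auto
    have "(int t ^ 2 + 4 * int g ^ 2) * (int y - int x) ^ 2 + (4 * int g * int t) * (int w - int z) ^ 2
      = (int t ^ 2 - 4 * int g ^ 2) * (int x + int y) ^ 2"
      using key[OF P(3,4)] by algebra
    then have "(y - x, w - z) \<in> E (g, t, x + y)"
      unfolding E_def using le by (auto simp: of_nat_diff)
    then show "s \<in> Sigma J E"
      unfolding s f_def J_def using gt P(1,2) le by auto
  qed
  moreover have "inj_on f (small_gcd_solutions H Y M)"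
  proof (rule inj_onI)
    fix s s' assume ss: "s \<in> small_gcd_solutions H Y M" "s' \<in> small_gcd_solutions H Y M" "f s = f s'"
    obtain x y z w x' y' z' w' where s: "s = (x, y, z, w)" "s' = (x', y', z', w')"
      by (cases s, cases s') auto
    obtain g t where gt: "par (x, y, z, w) = (g, t)" by fastforce
    have eqs: "par (x', y', z', w') = (g, t)" "x + y = x' + y'" "y - x = y' - x'" "w - z = w' - z'"
      using ss(3) gt unfolding s f_def by (auto intro: prod_eqI)
    have P: "g \<in> {1..H ^ 4}" "t \<in> {1..B}" "t * (x * y) = g * (z\<^sup>2 + w\<^sup>2)" "t * (z * w) = g * (x\<^sup>2 + y\<^sup>2)"
      using par[OF ss(1)[unfolded s] gt] by auto
    have P': "t * (x' * y') = g * (z'\<^sup>2 + w'\<^sup>2)" "t * (z' * w') = g * (x'\<^sup>2 + y'\<^sup>2)"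
      using par[OF ss(2)[unfolded s] eqs(1)] by auto
    have lt: "x < y" "x' < y'" "z < w" "z' < w'"
      using ss(1,2) unfolding s small_gcd_solutions_def by auto
    have xy: "x = x'" "y = y'" using eqs lt by linarith+
    have d: "int w - int z = int w' - int z'" using eqs(4) lt by linarith
    \<comment> \<open>The sum \<open>w + z\<close> is not a coordinate of \<open>f\<close>; the
      first relation in \<open>key\<close> recovers its square from \<open>g\<close>,
      \<open>t\<close>, \<open>x\<close>, \<open>y\<close> and \<open>w - z\<close>.\<close>
    have "int t * ((int w + int z)\<^sup>2 - (int w - int z)\<^sup>2) = int t * ((int w' + int z')\<^sup>2 - (int w' - int z')\<^sup>2)"
      using key(1)[OF P(3,4)] key(1)[OF P'] xy by simp
    then have "(int w + int z)\<^sup>2 = (int w' + int z')\<^sup>2" using P(2) d by simp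
    then have "int w + int z = int w' + int z'"
      by (simp add: power2_eq_iff_nonneg)
    then show "s = s'" using d xy unfolding s by simp
  qed
  moreover have finE: "finite (E j)" for j
    by (rule finite_subset[of _ "{..M} \<times> {..M}"]) (auto simp: E_def split: prod.splits)
  moreover have "finite J" unfolding J_def by simp
  ultimately have "card (small_gcd_solutions H Y M) \<le> card (Sigma J E)"
    by (intro card_inj_on_le) auto
  also have "\<dots> = (\<Sum>j\<in>J. card (E j))"
    using finE \<open>finite J\<close> by (intro card_SigmaI) auto
  also have "\<dots> \<le> (\<Sum>j\<in>J. 2 * (M div L) + 1 + (2 * L + 1) ^ 2)"
  proof (rule sum_mono)
    fix j assume "j \<in> J"
    then obtain g t X where j: "j = (g, t, X)" "g > 0" "t > 0"
      unfolding J_def by auto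
    show "card (E j) \<le> 2 * (M div L) + 1 + (2 * L + 1) ^ 2"
    proof (rule card_lattice_points_ellipse)
      show "0 < int t ^ 2 + 4 * int g ^ 2" "0 < 4 * int g * int t"
        using j by (auto intro: add_pos_pos)
      show "(int t ^ 2 + 4 * int g ^ 2) * int Z ^ 2 + (4 * int g * int t) * int V ^ 2
          = (int t ^ 2 - 4 * int g ^ 2) * int X ^ 2" if "(Z, V) \<in> E j" for Z V
        using that unfolding E_def j by auto
      show "E j \<subseteq> {..M} \<times> {..M}" unfolding E_def j by auto
    qed (rule assms)
  qed
  also have "\<dots> = H ^ 4 * B * (2 * M) * (2 * (M div L) + 1 + (2 * L + 1) ^ 2)"
    unfolding J_def by (simp add: card_cartesian_product)
  finally show ?thesis .
qed

section \<open>Splitting the nontrivial solutions by the size of \<open>z\<close> and of the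
  gcds\<close>

lemma quartic_strict_mono_right:
  assumes "x > 0" "y < y'"
  shows "quartic x y < quartic x y'"
  unfolding quartic_def using assms
  by (intro mult_strict_mono mult_strict_left_mono add_strict_left_mono power_strict_mono) auto

lemma quartic_commute: "quartic x y = quartic y x"
  by (simp add: quartic_def mult_ac add_ac)

lemma quartic_right_cancel:
  assumes "x > 0" "quartic x y = quartic x y'"
  shows "y = y'"
  using assms quartic_strict_mono_right by (metis less_irrefl nat_neq_iff)

definition quartic_solutions :: "nat \<Rightarrow> (nat \<times> nat \<times> nat \<times> nat) set" where
  "quartic_solutions M = {(x, y, z, w). {x, y, z, w} \<subseteq> {1..M} \<and> x < y \<and> z < w
     \<and> (x, y) \<noteq> (z, w) \<and> quartic x y = quartic z w}"

text \<open>For given \<open>z\<close> and \<open>w\<close>, the unknown \<open>x\<close> is a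
  divisor of \<open>quartic z w\<close>, and \<open>x\<close> then determines \<open>y\<close> by
  monotonicity.\<close>

lemma card_quartic_solutions_small_le:
  assumes T: "\<And>n. 0 < n \<Longrightarrow> n \<le> 2 * M ^ 4 \<Longrightarrow> tau n \<le> T"
  shows "card {(x, y, z, w) \<in> quartic_solutions M. z < Y} \<le> Y * M * T"
proof -
  let ?S = "{(x, y, z, w) \<in> quartic_solutions M. z < Y}"
  let ?J = "{1..<Y} \<times> {1..M}"
  \<comment> \<open>\<open>Y\<close> may exceed \<open>M\<close>; the empty value for
    \<open>z > M\<close> avoids divisor counts beyond the reach of \<open>T\<close>.\<close>
  define D where "D = (\<lambda>(z, w). if z \<le> M then {d. d dvd quartic z w} else {})"
  have "(\<lambda>(x, y, z, w). ((z, w), x)) ` ?S \<subseteq> Sigma ?J D"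
  proof -
    have "((z, w), x) \<in> Sigma ?J D" if "(x, y, z, w) \<in> quartic_solutions M" "z < Y" for x y z w
    proof -
      have "x dvd quartic x y" unfolding quartic_def by simp
      then show ?thesis
        using that unfolding quartic_solutions_def D_def by auto
    qed
    then show ?thesis by auto
  qed
  moreover have "inj_on (\<lambda>(x, y, z, w). ((z, w), x)) ?S"
  proof -
    have "y = y'" if "(x, y, z, w) \<in> quartic_solutions M" "(x, y', z, w) \<in> quartic_solutions M" for x y y' z w
      by (rule quartic_right_cancel[of x]) (use that in \<open>auto simp: quartic_solutions_def\<close>)
    then show ?thesis by (auto simp: inj_on_def)
  qed
  moreover have D: "finite (D j) \<and> card (D j) \<le> T" if "j \<in> ?J" for j
  proof -
    obtain z w where j: "j = (z, w)" by fastforce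
    have zw: "1 \<le> z" "1 \<le> w" "w \<le> M" using that j by auto
    then have pos: "quartic z w > 0" unfolding quartic_def by simp
    have "quartic z w \<le> M * M * (M\<^sup>2 + M\<^sup>2)" if "z \<le> M"
      unfolding quartic_def using zw that by (intro mult_le_mono add_mono power_mono) auto
    then have "quartic z w \<le> 2 * M ^ 4" if "z \<le> M"
      using that by (simp add: power_numeral_reduce algebra_simps)
    then show ?thesis
      unfolding D_def j using T[of "quartic z w"] pos finite_divisors_nat[OF pos] by auto
  qed
  ultimately have "card ?S \<le> card (Sigma ?J D)"
    by (intro card_inj_on_le finite_SigmaI) auto
  also have "\<dots> = (\<Sum>j\<in>?J. card (D j))"
    using D by (intro card_SigmaI) auto
  also have "\<dots> \<le> (\<Sum>j\<in>?J. T)"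
    using D by (intro sum_mono) auto
  also have "\<dots> = (Y - 1) * M * T" by (simp add: card_cartesian_product)
  also have "\<dots> \<le> Y * M * T" by (intro mult_le_mono) auto
  finally show ?thesis .
qed

lemma finite_quartic_solutions: "finite (quartic_solutions M)"
  by (rule finite_subset[of _ "{1..M} \<times> {1..M} \<times> {1..M} \<times> {1..M}"]) (auto simp: quartic_solutions_def)

lemma finite_large_gcd_solutions: "finite (large_gcd_solutions H M)"
  by (rule finite_subset[of _ "{1..M} \<times> {1..M} \<times> {1..M} \<times> {1..M}"]) (auto simp: large_gcd_solutions_def)

lemma finite_small_gcd_solutions: "finite (small_gcd_solutions H Y M)"
  by (rule finite_subset[of _ "{1..M} \<times> {1..M} \<times> {1..M} \<times> {1..M}"]) (auto simp: small_gcd_solutions_def)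

text \<open>If some gcd is at least \<open>H\<close>, compare it with the gcd of the two remaining
  variables and swap coordinates so that the larger one sits in the place of \<open>gcd x z\<close>.
  Monotonicity of \<open>quartic\<close> excludes a value common to both pairs, so the condition of
  distinct first and third coordinates holds after each swap.\<close>

lemma quartic_solutions_subset:
  "quartic_solutions M \<subseteq> {(x, y, z, w) \<in> quartic_solutions M. z < Y} \<union> small_gcd_solutions H Y M
     \<union> large_gcd_solutions H M
     \<union> (\<lambda>(x, y, z, w). (x, y, w, z)) ` large_gcd_solutions H M
     \<union> (\<lambda>(x, y, z, w). (y, x, z, w)) ` large_gcd_solutions H M
     \<union> (\<lambda>(x, y, z, w). (y, x, w, z)) ` large_gcd_solutions H M"
proof
  fix s assume s: "s \<in> quartic_solutions M"
  obtain x y z w where xyzw: "s = (x, y, z, w)" by (cases s) auto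
  have S: "{x, y, z, w} \<subseteq> {1..M}" "x < y" "z < w" "(x, y) \<noteq> (z, w)" and Q: "quartic x y = quartic z w"
    using s unfolding xyzw quartic_solutions_def by auto
  have ne: "x \<noteq> z" "y \<noteq> w" "x \<noteq> w" "y \<noteq> z"
  proof -
    show "x \<noteq> z" using S Q quartic_right_cancel[of x y w] by auto
    show "y \<noteq> w" using S Q quartic_right_cancel[of y x z] by (auto simp: quartic_commute)
    show "x \<noteq> w" using S Q quartic_right_cancel[of x y z] by (auto simp: quartic_commute)
    show "y \<noteq> z" using S Q quartic_right_cancel[of y x w] by (auto simp: quartic_commute)
  qed
  have Q2: "quartic x y = quartic w z" "quartic y x = quartic z w" "quartic y x = quartic w z"
    using Q quartic_commute by simp_all
  consider "z < Y" | "Y \<le> z" "gcd x z < H" "gcd x w < H" "gcd y z < H" "gcd y w < H"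
    | "H \<le> gcd x z" "gcd y w \<le> gcd x z" | "H \<le> gcd y w" "gcd x z \<le> gcd y w"
    | "H \<le> gcd x w" "gcd y z \<le> gcd x w" | "H \<le> gcd y z" "gcd x w \<le> gcd y z"
    by linarith
  then show "s \<in> {(x, y, z, w) \<in> quartic_solutions M. z < Y} \<union> small_gcd_solutions H Y M
     \<union> large_gcd_solutions H M
     \<union> (\<lambda>(x, y, z, w). (x, y, w, z)) ` large_gcd_solutions H M
     \<union> (\<lambda>(x, y, z, w). (y, x, z, w)) ` large_gcd_solutions H M
     \<union> (\<lambda>(x, y, z, w). (y, x, w, z)) ` large_gcd_solutions H M"
  proof cases
    case 1
    then show ?thesis using s xyzw by auto
  next
    case 2
    then have "s \<in> small_gcd_solutions H Y M"
      unfolding small_gcd_solutions_def xyzw using S Q by auto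
    then show ?thesis by blast
  next
    case 3
    then have "s \<in> large_gcd_solutions H M"
      unfolding large_gcd_solutions_def xyzw using S Q ne by auto
    then show ?thesis by blast
  next
    case 4
    then have "(y, x, w, z) \<in> large_gcd_solutions H M"
      unfolding large_gcd_solutions_def using S Q2 ne by auto
    then have "s \<in> (\<lambda>(x, y, z, w). (y, x, w, z)) ` large_gcd_solutions H M"
      unfolding xyzw by force
    then show ?thesis by blast
  next
    case 5
    then have "(x, y, w, z) \<in> large_gcd_solutions H M"
      unfolding large_gcd_solutions_def using S Q2 ne by auto
    then have "s \<in> (\<lambda>(x, y, z, w). (x, y, w, z)) ` large_gcd_solutions H M"
      unfolding xyzw by force
    then show ?thesis by blast
  next
    case 6
    then have "(y, x, z, w) \<in> large_gcd_solutions H M"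
      unfolding large_gcd_solutions_def using S Q2 ne by auto
    then have "s \<in> (\<lambda>(x, y, z, w). (y, x, z, w)) ` large_gcd_solutions H M"
      unfolding xyzw by force
    then show ?thesis by blast
  qed
qed

lemma card_quartic_solutions_le:
  "card (quartic_solutions M) \<le> card {(x, y, z, w) \<in> quartic_solutions M. z < Y}
     + card (small_gcd_solutions H Y M) + 4 * card (large_gcd_solutions H M)"
proof -
  let ?A = "large_gcd_solutions H M"
  have fin: "finite {(x, y, z, w) \<in> quartic_solutions M. z < Y}"
    by (rule finite_subset[OF _ finite_quartic_solutions]) auto
  have "card (quartic_solutions M) \<le> card ({(x, y, z, w) \<in> quartic_solutions M. z < Y} \<union> small_gcd_solutions H Y M
     \<union> ?A \<union> (\<lambda>(x, y, z, w). (x, y, w, z)) ` ?A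
     \<union> (\<lambda>(x, y, z, w). (y, x, z, w)) ` ?A \<union> (\<lambda>(x, y, z, w). (y, x, w, z)) ` ?A)"
    by (rule card_mono[OF _ quartic_solutions_subset])
      (use fin finite_large_gcd_solutions finite_small_gcd_solutions in blast)
  also have "\<dots> \<le> card {(x, y, z, w) \<in> quartic_solutions M. z < Y} + card (small_gcd_solutions H Y M)
     + card ?A + card ?A + card ?A + card ?A"
    by (intro order_trans[OF card_Un_le] add_mono order_refl card_image_le finite_large_gcd_solutions)
  finally show ?thesis by simp
qed

section \<open>Choice of parameters and the resulting count\<close>

lemma sum_inverse_le: "n > 0 \<Longrightarrow> (\<Sum>k = 1..n. 1 / real k) \<le> 1 + ln (real n)"
proof (induction n rule: nat_induct_non_zero)
  case (Suc n)
  have "ln (real n / real (Suc n)) \<le> real n / real (Suc n) - 1"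
    using Suc by (intro ln_le_minus_one) simp
  then have "1 / real (Suc n) \<le> ln (real (Suc n)) - ln (real n)"
    using Suc by (simp add: ln_div field_simps)
  then show ?case using Suc by simp
qed simp

text \<open>The divisor bound with the root extracted: numbers of size \<open>O(q^j)\<close> have
  \<open>O(q)\<close> divisors. This suits a count in which all parameters are powers of
  \<open>q\<close>.\<close>

lemma tau_le_of_le_power:
  assumes "j > 0"
  obtains C :: nat where "C \<ge> 1" "\<And>n q. 0 < n \<Longrightarrow> n \<le> K * q ^ j \<Longrightarrow> tau n \<le> C * q"
proof -
  obtain C :: nat where C: "C \<ge> 1" "\<And>n. n > 0 \<Longrightarrow> tau n ^ j \<le> C * n"
    using tau_power_le by blast
  have "tau n \<le> (C * (K + 1)) * q" if "0 < n" "n \<le> K * q ^ j" for n q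
  proof -
    have "tau n ^ j \<le> C * n" using C that by blast
    also have "\<dots> \<le> (C * (K + 1)) * q ^ j"
      using that(2) by (simp add: algebra_simps) (metis le_add1 le_trans mult.left_commute mult_le_mono2 add.commute)
    also have "\<dots> \<le> (C * (K + 1)) ^ j * q ^ j"
      using assms C(1) by (intro mult_le_mono1 self_le_power) auto
    finally have "tau n ^ j \<le> (C * (K + 1) * q) ^ j" by (simp only: power_mult_distrib)
    then show ?thesis using assms by (simp only: power_mono_iff)
  qed
  then show thesis using that[of "C * (K + 1)"] C(1) by auto
qed

text \<open>
  With \<open>N = q\<^bsup>54\<^esup>\<close> the parameters are \<open>M = 2 N\<close>, \<open>H = q\<^sup>2\<close>, \<open>Y = q\<^bsup>53\<^esup>\<close>, \<open>L = q\<^bsup>18\<^esup>\<close>; the divisor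
  bound is applied to numbers up to \<open>M\<^bsup>21\<^esup> = 2\<^bsup>21\<^esup> q\<^bsup>1134\<^esup>\<close>.
\<close>

proposition card_quartic_solutions_power_le:
  obtains C :: real where "\<And>q. q > 0 \<Longrightarrow> real (card (quartic_solutions (2 * q ^ 54))) \<le> C * real (q ^ 54) ^ 2"
proof -
  obtain C :: nat where C: "C \<ge> 1" "\<And>n q. 0 < n \<Longrightarrow> n \<le> 2 ^ 21 * q ^ 1134 \<Longrightarrow> tau n \<le> C * q"
    using tau_le_of_le_power[of 1134 "2 ^ 21"] by (metis zero_less_numeral)
  have "real (card (quartic_solutions (2 * q ^ 54))) \<le> (2 * real C + 448 + 5376 * real C) * real (q ^ 54) ^ 2"
    if "q > 0" for q :: nat
  proof -
    define M where "M = 2 * q ^ 54"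
    have "M \<ge> 2" unfolding M_def using that by simp
    have T: "tau n \<le> C * q" if "0 < n" "n \<le> M ^ 21" for n
    proof (rule C(2)[OF that(1)])
      show "n \<le> 2 ^ 21 * q ^ 1134"
        using that(2) unfolding M_def power_mult_distrib by (simp flip: power_mult)
    qed
    have "2 * M ^ 4 \<le> M * M ^ 4" using \<open>M \<ge> 2\<close> by simp
    also have "\<dots> = M ^ 5" by (simp add: power_numeral_reduce)
    also have "\<dots> \<le> M ^ 21" using \<open>M \<ge> 2\<close> by (intro power_increasing) auto
    finally have "2 * M ^ 4 \<le> M ^ 21" .
    then have "card {(x, y, z, w) \<in> quartic_solutions M. z < q ^ 53} \<le> q ^ 53 * M * (C * q)"
      by (intro card_quartic_solutions_small_le T) auto
    also have "\<dots> = 2 * C * (q ^ 54)\<^sup>2"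
      unfolding M_def by (simp add: power2_eq_square power_numeral_reduce)
    finally have small: "real (card {(x, y, z, w) \<in> quartic_solutions M. z < q ^ 53}) \<le> 2 * real C * real (q ^ 54) ^ 2"
      by (metis (mono_tags, lifting) of_nat_le_iff of_nat_mult of_nat_numeral of_nat_power)
    have "M div q ^ 18 = 2 * q ^ 36"
    proof -
      have "M = (2 * q ^ 36) * q ^ 18" unfolding M_def by (simp flip: power_add)
      then show ?thesis using that by simp
    qed
    \<comment> \<open>With \<open>B = 8 q^10\<close> the hypothesis on \<open>B\<close> is an
      equality, both sides being \<open>8 q^116\<close>. The choice of \<open>L\<close> balances
      \<open>M / L\<close> and \<open>L^2\<close>, both of order \<open>q^36\<close>; the constant
      is \<open>448 = 32 * (4 + 1 + 9)\<close>.\<close>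
    then have "card (small_gcd_solutions (q\<^sup>2) (q ^ 53) M)
        \<le> (q\<^sup>2) ^ 4 * (8 * q ^ 10) * (2 * M) * (2 * (2 * q ^ 36) + 1 + (2 * q ^ 18 + 1) ^ 2)"
      using card_small_gcd_solutions_le[of "q ^ 53" "q ^ 18" "q\<^sup>2" M "8 * q ^ 10"] that
      unfolding M_def by (simp add: power_mult_distrib flip: power_mult power_add)
    also have "\<dots> \<le> (q\<^sup>2) ^ 4 * (8 * q ^ 10) * (2 * M) * (2 * (2 * q ^ 36) + q ^ 36 + (2 * q ^ 18 + q ^ 18) ^ 2)"
      using that by (intro mult_le_mono2 add_mono power_mono) auto
    also have "\<dots> = 448 * (q ^ 54)\<^sup>2"
    proof -
      have 1: "(2 * q ^ 18 + q ^ 18) ^ 2 = 9 * q ^ 36"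
        by (simp add: power2_eq_square flip: power_add)
      show ?thesis
        unfolding 1 M_def by (simp flip: power_mult power_add)
    qed
    finally have B: "real (card (small_gcd_solutions (q\<^sup>2) (q ^ 53) M)) \<le> 448 * real (q ^ 54) ^ 2"
      by (metis (mono_tags, lifting) of_nat_le_iff of_nat_mult of_nat_numeral of_nat_power)
    \<comment> \<open>The divisor bound loses a factor \<open>q\<close> and the harmonic sum at most
      \<open>56 q\<close>; division by \<open>H = q^2\<close> absorbs both, and
      \<open>1344 = 6 * 4 * 56\<close>.\<close>
    have A: "real (card (large_gcd_solutions (q\<^sup>2) M)) \<le> 1344 * real C * real (q ^ 54) ^ 2"
    proof -
      have "ln (real M) = ln 2 + 54 * ln (real q)"
        unfolding M_def using that by (simp add: ln_mult ln_realpow)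
      also have "\<dots> \<le> 1 + 54 * real q"
        using ln_le_minus_one[of 2] ln_le_minus_one[of "real q"] that by simp
      finally have "(\<Sum>k = 1..M. 1 / real k) \<le> 56 * real q"
        using sum_inverse_le[of M] \<open>M \<ge> 2\<close> that by linarith
      have "real (card (large_gcd_solutions (q\<^sup>2) M))
          \<le> 6 * real (C * q) * real M ^ 2 / real (q\<^sup>2) * (\<Sum>k = 1..M. 1 / real k)"
        using that by (intro card_large_gcd_solutions_le T) auto
      also have "\<dots> \<le> 6 * real (C * q) * real M ^ 2 / real (q\<^sup>2) * (56 * real q)"
        by (intro mult_left_mono) (fact | simp)+
      also have "\<dots> = 1344 * real C * real (q ^ 54) ^ 2"
        unfolding M_def using that by (simp add: field_simps power2_eq_square)
      finally show ?thesis .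
    qed
    have "real (card (quartic_solutions M)) \<le> real (card {(x, y, z, w) \<in> quartic_solutions M. z < q ^ 53})
        + real (card (small_gcd_solutions (q\<^sup>2) (q ^ 53) M)) + 4 * real (card (large_gcd_solutions (q\<^sup>2) M))"
      using of_nat_mono[OF card_quartic_solutions_le[of M "q ^ 53" "q\<^sup>2"], where ?'a = real] by simp
    also have "\<dots> \<le> 2 * real C * real (q ^ 54) ^ 2 + 448 * real (q ^ 54) ^ 2 + 4 * (1344 * real C * real (q ^ 54) ^ 2)"
      using small A B by linarith
    also have "\<dots> = (2 * real C + 448 + 5376 * real C) * real (q ^ 54) ^ 2"
      by (simp add: algebra_simps)
    finally show ?thesis unfolding M_def .
  qed
  then show thesis using that by blast
qed

section \<open>Sums over differences of fourth powers\<close>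

definition quartic_pairs :: "nat \<Rightarrow> (nat \<times> nat) set" where
  "quartic_pairs N = {(m, n). 1 \<le> m \<and> m < n \<and> n \<le> N}"

definition quartic_diff :: "nat \<times> nat \<Rightarrow> nat" where
  "quartic_diff = (\<lambda>(m, n). n ^ 4 - m ^ 4)"

lemma quartic_pairs_subset: "quartic_pairs N \<subseteq> {1..N} \<times> {1..N}"
  unfolding quartic_pairs_def by auto

lemma finite_quartic_pairs: "finite (quartic_pairs N)"
  using quartic_pairs_subset by (rule finite_subset) simp

lemma quartic_minus_plus:
  assumes "m < n"
  shows "quartic (n - m) (n + m) = 2 * quartic_diff (m, n)"
proof -
  have "m ^ 4 \<le> n ^ 4" using assms by (intro power_mono) auto
  then have "int (quartic (n - m) (n + m)) = int (2 * quartic_diff (m, n))"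
    using assms unfolding quartic_def quartic_diff_def
    by (simp add: of_nat_diff) algebra
  then show ?thesis by (simp only: of_nat_eq_iff)
qed

text \<open>The additive energy of the differences: coinciding pairs give at most
  \<open>N^2\<close>, and the others are sent injectively to nontrivial solutions by
  \<open>(m, n) -> (n - m, n + m)\<close>, whose entries are at most \<open>2 N\<close>.\<close>

lemma card_quartic_energy_le:
  "card {(p, p') \<in> quartic_pairs N \<times> quartic_pairs N. quartic_diff p = quartic_diff p'}
    \<le> N\<^sup>2 + card (quartic_solutions (2 * N))"
proof -
  let ?P = "quartic_pairs N"
  let ?S = "{(p, p') \<in> ?P \<times> ?P. quartic_diff p = quartic_diff p'}"
  let ?D = "(\<lambda>p. (p, p)) ` ?P"
  define f :: "(nat \<times> nat) \<times> (nat \<times> nat) \<Rightarrow> nat \<times> nat \<times> nat \<times> nat" where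
    "f = (\<lambda>((m, n), (m', n')). (n - m, n + m, n' - m', n' + m'))"
  have finS: "finite ?S"
    by (rule finite_subset[of _ "?P \<times> ?P"]) (auto simp: finite_quartic_pairs)
  have "card ?D \<le> card ({1..N} \<times> {1..N})"
    using card_image_le[OF finite_quartic_pairs] card_mono[OF _ quartic_pairs_subset]
    by (meson finite_SigmaI finite_atLeastAtMost le_trans)
  then have D: "card ?D \<le> N\<^sup>2" by (simp add: card_cartesian_product power2_eq_square)
  have "inj_on f (?S - ?D)"
    by (rule inj_onI) (auto simp: f_def quartic_pairs_def)
  moreover have "f ` (?S - ?D) \<subseteq> quartic_solutions (2 * N)"
  proof
    fix s assume "s \<in> f ` (?S - ?D)"
    then obtain r where r: "s = f r" "r \<in> ?S" "r \<notin> ?D" by blast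
    obtain p p' where "r = (p, p')" by (cases r)
    then have pp: "s = f (p, p')" "p \<in> ?P" "p' \<in> ?P" "quartic_diff p = quartic_diff p'" "p \<noteq> p'"
      using r by blast+
    obtain m n m' n' where mn: "p = (m, n)" "p' = (m', n')" by (cases p, cases p') auto
    note * = pp[unfolded mn]
    then have lt: "1 \<le> m" "m < n" "n \<le> N" "1 \<le> m'" "m' < n'" "n' \<le> N"
      unfolding quartic_pairs_def by auto
    then have "quartic (n - m) (n + m) = quartic (n' - m') (n' + m')"
      using *(4) by (simp only: quartic_minus_plus)
    then show "s \<in> quartic_solutions (2 * N)"
      using lt *(5) unfolding *(1) f_def quartic_solutions_def by auto
  qed
  ultimately have "card (?S - ?D) \<le> card (quartic_solutions (2 * N))"
    using finite_quartic_solutions by (rule card_inj_on_le)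
  moreover have "card ?S \<le> card ?D + card (?S - ?D)"
    using card_Un_le[of ?D "?S - ?D"] card_mono[of "?D \<union> (?S - ?D)" ?S] finS finite_quartic_pairs
    by (auto intro: le_trans)
  ultimately show ?thesis using D by linarith
qed

text \<open>Group the sum by the values of \<open>f\<close> and apply Cauchy-Schwarz; the sum of the
  squared multiplicities \<open>R k\<close> counts the collisions of \<open>f\<close>.\<close>

lemma sum_comp_squared_le:
  fixes f :: "'a \<Rightarrow> 'b" and h :: "'b \<Rightarrow> real"
  assumes "finite S"
  shows "(\<Sum>s\<in>S. h (f s))\<^sup>2 \<le> real (card {(s, t) \<in> S \<times> S. f s = f t}) * (\<Sum>k\<in>f ` S. (h k)\<^sup>2)"
proof -
  define R where "R k = card {s \<in> S. f s = k}" for k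
  have "(\<Sum>s\<in>S. h (f s)) = (\<Sum>k\<in>f ` S. \<Sum>s\<in>{s \<in> S. f s = k}. h (f s))"
    using assms by (rule sum.image_gen)
  also have "\<dots> = (\<Sum>k\<in>f ` S. real (R k) * h k)"
    unfolding R_def by (intro sum.cong) auto
  finally have "(\<Sum>s\<in>S. h (f s))\<^sup>2 \<le> (\<Sum>k\<in>f ` S. (real (R k))\<^sup>2) * (\<Sum>k\<in>f ` S. (h k)\<^sup>2)"
    using Cauchy_Schwarz_ineq_sum by simp
  moreover have "(\<Sum>k\<in>f ` S. (real (R k))\<^sup>2) = real (card {(s, t) \<in> S \<times> S. f s = f t})"
  proof -
    have "{(s, t) \<in> S \<times> S. f s = f t} = (SIGMA s:S. {t \<in> S. f t = f s})" by auto
    then have "card {(s, t) \<in> S \<times> S. f s = f t} = (\<Sum>s\<in>S. R (f s))"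
      using assms unfolding R_def by simp
    also have "\<dots> = (\<Sum>k\<in>f ` S. \<Sum>s\<in>{s \<in> S. f s = k}. R (f s))"
      using assms by (rule sum.image_gen)
    also have "\<dots> = (\<Sum>k\<in>f ` S. R k * R k)"
      unfolding R_def by (intro sum.cong) auto
    finally show ?thesis by (simp add: power2_eq_square)
  qed
  ultimately show ?thesis by simp
qed

text \<open>Differences below a fixed \<open>K\<close> come from boundedly many pairs, whatever
  \<open>q\<close> is. On the others, Cauchy-Schwarz combines the energy bound \<open>O(N^2)\<close>
  with the arbitrarily small tail of the sum of the \<open>(h k)^2\<close>. The values
  \<open>N = q ^ 54\<close> are those for which the energy bound is available.\<close>

proposition sum_quartic_diff_small:
  fixes h :: "nat \<Rightarrow> real"
  assumes h: "\<And>k. h k \<ge> 0" and B: "\<And>K. finite K \<Longrightarrow> (\<Sum>k\<in>K. (h k)\<^sup>2) \<le> B" and "\<epsilon> > 0"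
  shows "\<exists>Q. \<forall>q\<ge>Q. (\<Sum>p\<in>quartic_pairs (q ^ 54). h (quartic_diff p)) \<le> \<epsilon> * real (q ^ 54)"
proof -
  obtain C :: real where C: "\<And>q. q > 0 \<Longrightarrow> real (card (quartic_solutions (2 * q ^ 54))) \<le> C * real (q ^ 54) ^ 2"
    using card_quartic_solutions_power_le by blast
  define D where "D = 1 + \<bar>C\<bar>"
  have "D > 0" unfolding D_def by simp
  have "summable (\<lambda>k. (h k)\<^sup>2)"
    using B by (intro summableI_nonneg_bounded[where x = B]) auto
  \<comment> \<open>Chosen so that \<open>D * N^2 * \<delta>\<close> is the square of
    \<open>\<epsilon> / 2 * N\<close>.\<close>
  moreover define \<delta> where "\<delta> = (\<epsilon> / 2)\<^sup>2 / D"
  have "\<delta> > 0" unfolding \<delta>_def using \<open>\<epsilon> > 0\<close> \<open>D > 0\<close> by simp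
  ultimately obtain K where K: "\<And>m n. m \<ge> K \<Longrightarrow> norm (\<Sum>k = m..<n. (h k)\<^sup>2) < \<delta>"
    unfolding summable_Cauchy by blast
  have tail: "(\<Sum>k\<in>A. (h k)\<^sup>2) \<le> \<delta>" if "finite A" "A \<subseteq> {K..}" for A
  proof -
    have "A \<subseteq> {K..<Suc (Max A)}" using that by (auto simp: less_Suc_eq_le)
    then have "(\<Sum>k\<in>A. (h k)\<^sup>2) \<le> (\<Sum>k = K..<Suc (Max A). (h k)\<^sup>2)"
      by (intro sum_mono2) auto
    then show ?thesis using K[of K "Suc (Max A)"] by simp
  qed
  have hB: "h k \<le> B + 1" for k
  proof -
    have "(h k)\<^sup>2 \<le> B" using B[of "{k}"] by simp
    moreover have "2 * h k \<le> (h k)\<^sup>2 + 1"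
      using zero_le_power2[of "h k - 1"] by (simp add: power2_diff)
    ultimately show ?thesis using h[of k] by linarith
  qed
  \<comment> \<open>From this point on, the at most \<open>K^2\<close> pairs with a small
    difference, each of weight at most \<open>B + 1\<close>, contribute at most
    \<open>\<epsilon> / 2 * N\<close>.\<close>
  define Q where "Q = nat \<lceil>2 * (real K)\<^sup>2 * (B + 1) / \<epsilon>\<rceil> + 1"
  have "(\<Sum>p\<in>quartic_pairs (q ^ 54). h (quartic_diff p)) \<le> \<epsilon> * real (q ^ 54)" if "q \<ge> Q" for q
  proof -
    have "q > 0" using that unfolding Q_def by simp
    define N where "N = q ^ 54"
    define P where "P = quartic_pairs N"
    define L where "L = {p \<in> P. quartic_diff p < K}"
    have finP: "finite P" unfolding P_def by (rule finite_quartic_pairs)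
    have "L \<subseteq> {..<K} \<times> {..<K}"
    proof
      fix p assume "p \<in> L"
      then obtain m n where p: "p = (m, n)" "m < n" "n ^ 4 - m ^ 4 < K"
        unfolding L_def P_def quartic_pairs_def quartic_diff_def by auto
      \<comment> \<open>This yields \<open>n^4 - m^4 >= n\<close>, so a difference below
        \<open>K\<close> forces both entries below \<open>K\<close>.\<close>
      have "m ^ 4 + n \<le> m * n ^ 3 + n ^ 3"
      proof (rule add_mono)
        have "m ^ 3 \<le> n ^ 3" using p(2) by (intro power_mono) auto
        then have "m * m ^ 3 \<le> m * n ^ 3" by simp
        then show "m ^ 4 \<le> m * n ^ 3" by (simp add: power_numeral_reduce)
        show "n \<le> n ^ 3" using p(2) by (intro self_le_power) auto
      qed
      also have "\<dots> = (m + 1) * n ^ 3" by simp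
      also have "\<dots> \<le> n * n ^ 3" using p(2) by (intro mult_le_mono1) auto
      also have "\<dots> = n ^ 4" by (simp add: power_numeral_reduce)
      finally have "n \<le> n ^ 4 - m ^ 4" by linarith
      then show "p \<in> {..<K} \<times> {..<K}" using p by auto
    qed
    then have "card L \<le> card ({..<K} \<times> {..<K})" by (intro card_mono) auto
    then have cL: "real (card L) \<le> (real K)\<^sup>2"
      by (simp add: card_cartesian_product power2_eq_square flip: of_nat_mult)
    have "B \<ge> 0" using B[of "{}"] by simp
    have "(\<Sum>p\<in>L. h (quartic_diff p)) \<le> real (card L) * (B + 1)"
      using hB by (intro sum_bounded_above) auto
    also have "\<dots> \<le> (real K)\<^sup>2 * (B + 1)"
      using cL \<open>B \<ge> 0\<close> by (intro mult_right_mono) auto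
    also have "\<dots> \<le> \<epsilon> / 2 * real N"
    proof -
      have "2 * (real K)\<^sup>2 * (B + 1) / \<epsilon> \<le> real Q"
        unfolding Q_def by linarith
      also have "\<dots> \<le> real q" using that by simp
      also have "\<dots> \<le> real N"
        unfolding N_def using \<open>q > 0\<close> by (simp only: of_nat_le_iff) (intro self_le_power, auto)
      finally show ?thesis using \<open>\<epsilon> > 0\<close> by (simp add: field_simps)
    qed
    finally have low: "(\<Sum>p\<in>L. h (quartic_diff p)) \<le> \<epsilon> / 2 * real N" .
    have "(\<Sum>p\<in>P - L. h (quartic_diff p))\<^sup>2
        \<le> real (card {(s, t) \<in> (P - L) \<times> (P - L). quartic_diff s = quartic_diff t})
          * (\<Sum>k\<in>quartic_diff ` (P - L). (h k)\<^sup>2)"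
      using finP by (intro sum_comp_squared_le) auto
    also have "\<dots> \<le> (D * (real N)\<^sup>2) * \<delta>"
    proof (rule mult_mono)
      have "card {(s, t) \<in> (P - L) \<times> (P - L). quartic_diff s = quartic_diff t}
          \<le> card {(s, t) \<in> P \<times> P. quartic_diff s = quartic_diff t}"
        by (rule card_mono, rule finite_subset[of _ "P \<times> P"]) (auto simp: finP)
      also have "\<dots> \<le> N\<^sup>2 + card (quartic_solutions (2 * N))"
        unfolding P_def by (rule card_quartic_energy_le)
      finally have "real (card {(s, t) \<in> (P - L) \<times> (P - L). quartic_diff s = quartic_diff t})
          \<le> real (N\<^sup>2 + card (quartic_solutions (2 * N)))"
        by (rule of_nat_mono)
      also have "\<dots> \<le> (real N)\<^sup>2 + C * (real N)\<^sup>2"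
        using C[OF \<open>q > 0\<close>] unfolding N_def by simp
      also have "\<dots> \<le> D * (real N)\<^sup>2"
        unfolding D_def by (simp add: distrib_right mult_right_mono)
      finally show "real (card {(s, t) \<in> (P - L) \<times> (P - L). quartic_diff s = quartic_diff t}) \<le> D * (real N)\<^sup>2" .
      show "(\<Sum>k\<in>quartic_diff ` (P - L). (h k)\<^sup>2) \<le> \<delta>"
        by (rule tail) (auto simp: finP L_def)
    qed (use \<open>D > 0\<close> in \<open>auto intro: sum_nonneg\<close>)
    also have "\<dots> = (\<epsilon> / 2 * real N)\<^sup>2"
      unfolding \<delta>_def using \<open>D > 0\<close> by (simp add: power_mult_distrib power_divide)
    finally have high: "(\<Sum>p\<in>P - L. h (quartic_diff p)) \<le> \<epsilon> / 2 * real N"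
      using \<open>\<epsilon> > 0\<close> by (elim power2_le_imp_le) simp
    have "(\<Sum>p\<in>P. h (quartic_diff p)) = (\<Sum>p\<in>P - L. h (quartic_diff p)) + (\<Sum>p\<in>L. h (quartic_diff p))"
      using finP unfolding L_def by (intro sum.subset_diff) auto
    then show ?thesis using low high unfolding P_def N_def by linarith
  qed
  then show ?thesis by blast
qed

section \<open>Fourier coefficients of sets\<close>

abbreviation unit_leb :: "real measure" where
  "unit_leb \<equiv> lebesgue_on {0..1}"

lemma norm_e [simp]: "norm (e x) = 1"
  unfolding e_def by (simp add: norm_exp_eq_Re)

lemma cnj_e: "cnj (e x) = e (- x)"
  unfolding e_def by (simp add: exp_cnj)

lemma e_mult: "e x * e y = e (x + y)"
  unfolding e_def by (simp add: algebra_simps flip: exp_add)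

lemma e_zero [simp]: "e 0 = 1"
  unfolding e_def by simp

lemma continuous_on_e [continuous_intros]:
  "continuous_on S f \<Longrightarrow> continuous_on S (\<lambda>x. e (f x))"
  unfolding e_def by (intro continuous_intros)

lemma e_borel_measurable_lebesgue: "(\<lambda>x. e (x * r)) \<in> borel_measurable lebesgue"
proof -
  have "continuous_on UNIV (\<lambda>x. e (x * r))" by (intro continuous_intros)
  then have "(\<lambda>x. e (x * r)) \<in> borel_measurable borel"
    by (rule borel_measurable_continuous_onI)
  then show ?thesis by (intro measurable_completion) simp
qed

lemma finite_measure_unit_leb: "finite_measure unit_leb"
  by (rule finite_measure_lebesgue_on) auto

lemma e_measurable [measurable]: "(\<lambda>x. e (x * r)) \<in> borel_measurable unit_leb"
  using e_borel_measurable_lebesgue by (rule measurable_restrict_space1)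

lemma integrable_e [simp, intro]: "integrable unit_leb (\<lambda>x. e (x * r))"
  by (rule finite_measure.integrable_const_bound[OF finite_measure_unit_leb, where B = 1]) auto

lemma integral_e:
  "integral\<^sup>L unit_leb (\<lambda>x. e (x * of_int k)) = (if k = 0 then 1 else 0)"
proof -
  have eq: "integral\<^sup>L unit_leb (\<lambda>x. e (x * of_int k)) = integral {0..1} (\<lambda>x. e (x * of_int k))"
    by (rule lebesgue_integral_eq_integral) auto
  show ?thesis
  proof (cases "k = 0")
    case True
    then show ?thesis using eq by simp
  next
    case False
    define f where "f x = e (x * of_int k) / (2 * of_real pi * \<i> * of_int k)" for x :: real
    have "((\<lambda>x. e (x * of_int k)) has_integral (f 1 - f 0)) {0..1}"
    proof (rule fundamental_theorem_of_calculus)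
      fix x :: real assume "x \<in> {0..1}"
      have "((\<lambda>z. exp (2 * of_real pi * \<i> * (z * of_int k)) / (2 * of_real pi * \<i> * of_int k))
          has_field_derivative exp (2 * of_real pi * \<i> * (of_real x * of_int k))) (at (of_real x))"
        using False by (auto intro!: derivative_eq_intros)
      then have "((\<lambda>z. exp (2 * of_real pi * \<i> * (of_real z * of_int k)) / (2 * of_real pi * \<i> * of_int k))
          has_vector_derivative exp (2 * of_real pi * \<i> * (of_real x * of_int k))) (at x within {0..1})"
        by (rule has_vector_derivative_real_field)
      then show "(f has_vector_derivative e (x * of_int k)) (at x within {0..1})"
        unfolding f_def e_def by simp
    qed simp
    moreover have "e (of_int k) = 1"
      unfolding e_def using exp_integer_2pi[of "of_int k"] by (simp add: mult_ac)
    ultimately have "((\<lambda>x. e (x * of_int k)) has_integral 0) {0..1}"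
      unfolding f_def by simp
    then show ?thesis using eq False by (simp add: integral_unique)
  qed
qed

text \<open>The conjugate of the usual coefficient: the positive sign matches the exponentials in
  the expansion of the squared Weyl sum.\<close>

definition fourier_coeff :: "real set \<Rightarrow> int \<Rightarrow> complex" where
  "fourier_coeff G k = (\<integral>x. indicator G x * e (x * of_int k) \<partial>unit_leb)"

lemma integrable_indicator_mult_e:
  assumes "G \<in> sets unit_leb"
  shows "integrable unit_leb (\<lambda>x. indicator G x * e (x * r))"
proof -
  have "(\<lambda>x. indicator G x * e (x * r)) = (\<lambda>x. indicator G x *\<^sub>R e (x * r))"
    by (auto simp: indicator_def)
  then show ?thesis
    by (simp only:) (intro integrable_mult_indicator assms integrable_e)
qed

lemma fourier_coeff_0:
  assumes "G \<in> sets unit_leb"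
  shows "fourier_coeff G 0 = of_real (measure unit_leb G)"
proof -
  have "fourier_coeff G 0 = (\<integral>x. of_real (indicator G x) \<partial>unit_leb)"
    unfolding fourier_coeff_def by (simp add: of_real_indicator)
  also have "\<dots> = of_real (measure unit_leb G)"
    using assms sets.sets_into_space[OF assms] by (simp add: integral_complex_of_real Int_absorb2)
  finally show ?thesis .
qed

lemma fourier_coeff_minus: "fourier_coeff G (- k) = cnj (fourier_coeff G k)"
proof -
  have "cnj (fourier_coeff G k) = (\<integral>x. cnj (indicator G x * e (x * of_int k)) \<partial>unit_leb)"
    unfolding fourier_coeff_def by (rule Bochner_Integration.integral_cnj[symmetric])
  also have "\<dots> = fourier_coeff G (- k)"
    unfolding fourier_coeff_def by (intro Bochner_Integration.integral_cong) (auto simp: cnj_e indicator_def)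
  finally show ?thesis by simp
qed

text \<open>\<open>T\<close> is the orthogonal projection of the indicator of \<open>G\<close> onto
  the chosen characters. The integrals of \<open>1_G T\<close>, of \<open>1_G cnj T\<close> and of
  \<open>T cnj T\<close> all equal \<open>S\<close>, so the integral of the square of the norm of
  \<open>1_G - T\<close> is the measure of \<open>G\<close> minus \<open>S\<close>, and it is
  nonnegative.\<close>

lemma bessel_inequality:
  assumes G: "G \<in> sets unit_leb" and "finite K"
  shows "(\<Sum>k\<in>K. norm (fourier_coeff G k) ^ 2) \<le> measure unit_leb G"
proof -
  let ?c = "fourier_coeff G"
  define T where "T x = (\<Sum>k\<in>K. ?c k * e (x * of_int (- k)))" for x
  define S where "S = (\<Sum>k\<in>K. norm (?c k) ^ 2)"
  have c2: "?c k * ?c (- k) = of_real (norm (?c k) ^ 2)" for k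
    unfolding fourier_coeff_minus by (simp only: complex_norm_square)
  have cT: "cnj (T x) = (\<Sum>k\<in>K. ?c (- k) * e (x * of_int k))" for x
    unfolding T_def by (simp add: cnj_e fourier_coeff_minus)
  have i1: "integrable unit_leb (\<lambda>x. indicator G x * T x)"
    and v1: "(\<integral>x. indicator G x * T x \<partial>unit_leb) = of_real S"
  proof -
    have eq: "(\<lambda>x. indicator G x * T x) = (\<lambda>x. \<Sum>k\<in>K. ?c k * (indicator G x * e (x * of_int (- k))))"
      unfolding T_def by (simp add: sum_distrib_left mult_ac)
    show "integrable unit_leb (\<lambda>x. indicator G x * T x)"
      unfolding eq by (intro Bochner_Integration.integrable_sum integrable_mult_right integrable_indicator_mult_e G)
    have "(\<integral>x. indicator G x * T x \<partial>unit_leb) = (\<Sum>k\<in>K. ?c k * ?c (- k))"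
      unfolding eq fourier_coeff_def[of G "- _"]
      by (subst Bochner_Integration.integral_sum)
        (simp_all only: integral_mult_right_zero integrable_mult_right integrable_indicator_mult_e G)
    then show "(\<integral>x. indicator G x * T x \<partial>unit_leb) = of_real S"
      unfolding c2 S_def by simp
  qed
  have i2: "integrable unit_leb (\<lambda>x. indicator G x * cnj (T x))"
    and v2: "(\<integral>x. indicator G x * cnj (T x) \<partial>unit_leb) = of_real S"
  proof -
    have eq: "(\<lambda>x. indicator G x * cnj (T x)) = (\<lambda>x. cnj (indicator G x * T x))"
      by (auto simp: indicator_def)
    show "integrable unit_leb (\<lambda>x. indicator G x * cnj (T x))"
      unfolding eq by (rule integrable_cnj[OF i1])
    show "(\<integral>x. indicator G x * cnj (T x) \<partial>unit_leb) = of_real S"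
      unfolding eq Bochner_Integration.integral_cnj v1 by simp
  qed
  have i3: "integrable unit_leb (\<lambda>x. T x * cnj (T x))"
    and v3: "(\<integral>x. T x * cnj (T x) \<partial>unit_leb) = of_real S"
  proof -
    have eq: "(\<lambda>x. T x * cnj (T x)) = (\<lambda>x. \<Sum>k\<in>K. \<Sum>l\<in>K. ?c k * ?c (- l) * e (x * of_int (l - k)))"
    proof -
      have "e (x * of_int (l - k)) = e (x * of_int (- k)) * e (x * of_int l)" for x :: real and k l
        unfolding e_mult by (simp add: right_diff_distrib)
      then show ?thesis
        unfolding cT unfolding T_def sum_product by (simp only: mult_ac)
    qed
    show "integrable unit_leb (\<lambda>x. T x * cnj (T x))"
      unfolding eq by (intro Bochner_Integration.integrable_sum integrable_mult_right integrable_e)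
    have "(\<integral>x. T x * cnj (T x) \<partial>unit_leb)
        = (\<Sum>k\<in>K. \<Sum>l\<in>K. ?c k * ?c (- l) * (\<integral>x. e (x * of_int (l - k)) \<partial>unit_leb))"
      unfolding eq
    proof -
      have int: "integrable unit_leb (\<lambda>x. ?c k * ?c (- l) * e (x * of_int (l - k)))" for k l
        by (intro integrable_mult_right integrable_e)
      have "(\<integral>x. (\<Sum>k\<in>K. \<Sum>l\<in>K. ?c k * ?c (- l) * e (x * of_int (l - k))) \<partial>unit_leb)
          = (\<Sum>k\<in>K. \<integral>x. (\<Sum>l\<in>K. ?c k * ?c (- l) * e (x * of_int (l - k))) \<partial>unit_leb)"
        by (intro Bochner_Integration.integral_sum Bochner_Integration.integrable_sum int)
      also have "\<dots> = (\<Sum>k\<in>K. \<Sum>l\<in>K. \<integral>x. ?c k * ?c (- l) * e (x * of_int (l - k)) \<partial>unit_leb)"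
        by (intro sum.cong refl Bochner_Integration.integral_sum int)
      finally show "(\<integral>x. (\<Sum>k\<in>K. \<Sum>l\<in>K. ?c k * ?c (- l) * e (x * of_int (l - k))) \<partial>unit_leb)
        = (\<Sum>k\<in>K. \<Sum>l\<in>K. ?c k * ?c (- l) * (\<integral>x. e (x * of_int (l - k)) \<partial>unit_leb))"
        by (simp only: integral_mult_right_zero)
    qed
    also have "\<dots> = (\<Sum>k\<in>K. \<Sum>l\<in>K. if l = k then ?c k * ?c (- l) else 0)"
      unfolding integral_e by (intro sum.cong) auto
    also have "\<dots> = (\<Sum>k\<in>K. ?c k * ?c (- k))"
      using assms(2) by (simp add: sum.delta)
    finally show "(\<integral>x. T x * cnj (T x) \<partial>unit_leb) = of_real S"
      unfolding c2 S_def by simp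
  qed
  have i0: "integrable unit_leb (\<lambda>x. indicator G x :: complex)"
    using integrable_indicator_mult_e[OF G, of 0] by simp
  have v0: "(\<integral>x. indicator G x \<partial>unit_leb) = complex_of_real (measure unit_leb G)"
    using fourier_coeff_0[OF G] unfolding fourier_coeff_def by simp
  have sq: "of_real (norm (indicator G x - T x) ^ 2)
      = indicator G x - indicator G x * T x - indicator G x * cnj (T x) + T x * cnj (T x)" for x
    unfolding complex_norm_square by (simp add: indicator_def algebra_simps)
  have "complex_of_real (\<integral>x. norm (indicator G x - T x) ^ 2 \<partial>unit_leb)
      = (\<integral>x. of_real (norm (indicator G x - T x) ^ 2) \<partial>unit_leb)"
    by (rule integral_complex_of_real[symmetric])
  also have "\<dots> = of_real (measure unit_leb G) - of_real S - of_real S + of_real S"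
    unfolding sq using i0 i1 i2 i3 v0 v1 v2 v3 by simp
  also have "\<dots> = of_real (measure unit_leb G - S)" by simp
  finally have "(\<integral>x. norm (indicator G x - T x) ^ 2 \<partial>unit_leb) = measure unit_leb G - S"
    by (simp only: of_real_eq_iff)
  moreover have "(\<integral>x. norm (indicator G x - T x) ^ 2 \<partial>unit_leb) \<ge> 0"
    by (rule Bochner_Integration.integral_nonneg) simp
  ultimately show ?thesis unfolding S_def by simp
qed

section \<open>Mean squares of Weyl sums\<close>

lemma norm_weyl_sum_squared:
  "of_real (norm (weyl_sum a 4 N x) ^ 2)
    = (\<Sum>m = 1..N. \<Sum>n = 1..N. a m * cnj (a n) * e (x * of_int (int m ^ 4 - int n ^ 4)))"
proof -
  have eq: "e (x * of_int (int m ^ 4 - int n ^ 4)) = e (x * real m ^ 4) * e (- (x * real n ^ 4))" for m n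
    unfolding e_mult by (simp add: right_diff_distrib)
  have "of_real (norm (weyl_sum a 4 N x) ^ 2) = weyl_sum a 4 N x * cnj (weyl_sum a 4 N x)"
    by (simp only: complex_norm_square)
  also have "\<dots> = (\<Sum>m = 1..N. \<Sum>n = 1..N. (a m * e (x * real m ^ 4)) * (cnj (a n) * e (- (x * real n ^ 4))))"
    unfolding weyl_sum_def sum_product cnj_sum complex_cnj_mult cnj_e ..
  finally show ?thesis unfolding eq by (simp only: mult_ac)
qed

lemma weyl_sum_measurable [measurable]: "weyl_sum a d N \<in> borel_measurable borel"
proof -
  have "continuous_on UNIV (weyl_sum a d N)"
    unfolding weyl_sum_def by (intro continuous_intros)
  then show ?thesis by (rule borel_measurable_continuous_onI)
qed

lemma integral_indicator_weyl_sum_squared: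
  assumes G: "G \<in> sets unit_leb"
  shows "of_real (\<integral>x. indicator G x * norm (weyl_sum a 4 N x) ^ 2 \<partial>unit_leb)
    = (\<Sum>m = 1..N. \<Sum>n = 1..N. a m * cnj (a n) * fourier_coeff G (int m ^ 4 - int n ^ 4))" (is ?eq)
    and "integrable unit_leb (\<lambda>x. indicator G x * norm (weyl_sum a 4 N x) ^ 2)" (is ?int)
proof -
  have int: "integrable unit_leb (\<lambda>x. a m * cnj (a n) * (indicator G x * e (x * of_int (int m ^ 4 - int n ^ 4))))" for m n
    by (intro integrable_mult_right integrable_indicator_mult_e G)
  have eq: "(\<lambda>x. complex_of_real (indicator G x * norm (weyl_sum a 4 N x) ^ 2))
    = (\<lambda>x. \<Sum>m = 1..N. \<Sum>n = 1..N. a m * cnj (a n) * (indicator G x * e (x * of_int (int m ^ 4 - int n ^ 4))))"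
    unfolding of_real_mult of_real_indicator norm_weyl_sum_squared
    by (simp only: sum_distrib_left mult_ac)
  have "integrable unit_leb (\<lambda>x. complex_of_real (indicator G x * norm (weyl_sum a 4 N x) ^ 2))"
    unfolding eq by (intro Bochner_Integration.integrable_sum int)
  then show ?int by (simp only: complex_of_real_integrable_eq)
  have "of_real (\<integral>x. indicator G x * norm (weyl_sum a 4 N x) ^ 2 \<partial>unit_leb)
    = (\<integral>x. complex_of_real (indicator G x * norm (weyl_sum a 4 N x) ^ 2) \<partial>unit_leb)"
    by (rule integral_complex_of_real[symmetric])
  also have "\<dots> = (\<Sum>m = 1..N. \<integral>x. (\<Sum>n = 1..N. a m * cnj (a n) * (indicator G x * e (x * of_int (int m ^ 4 - int n ^ 4)))) \<partial>unit_leb)"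
    unfolding eq by (intro Bochner_Integration.integral_sum Bochner_Integration.integrable_sum int)
  also have "\<dots> = (\<Sum>m = 1..N. \<Sum>n = 1..N. \<integral>x. a m * cnj (a n) * (indicator G x * e (x * of_int (int m ^ 4 - int n ^ 4))) \<partial>unit_leb)"
    by (intro sum.cong refl Bochner_Integration.integral_sum int)
  finally show ?eq
    unfolding fourier_coeff_def by (simp only: integral_mult_right_zero)
qed

text \<open>As the \<open>a n\<close> have modulus 1, the diagonal contributes exactly
  \<open>N\<close> times the measure of \<open>G\<close>. The terms above and below the diagonal
  carry conjugate Fourier coefficients, so the same bound applies to both, whence the factor
  2.\<close>

lemma integral_weyl_sum_squared_ge:
  assumes G: "G \<in> sets unit_leb" and a: "\<And>n. n \<ge> 1 \<Longrightarrow> norm (a n) = 1"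
  shows "(\<integral>x. indicator G x * norm (weyl_sum a 4 N x) ^ 2 \<partial>unit_leb)
    \<ge> real N * measure unit_leb G
      - 2 * (\<Sum>p\<in>quartic_pairs N. norm (fourier_coeff G (int (quartic_diff p))))"
proof -
  let ?t = "\<lambda>m n. a m * cnj (a n) * fourier_coeff G (int m ^ 4 - int n ^ 4)"
  let ?J = "\<integral>x. indicator G x * norm (weyl_sum a 4 N x) ^ 2 \<partial>unit_leb"
  define P' where "P' = (\<lambda>(m, n). (n, m)) ` quartic_pairs N"
  define D where "D = (\<lambda>n. (n, n)) ` {1..N}"
  have split: "{1..N} \<times> {1..N} = D \<union> (quartic_pairs N \<union> P')"
    unfolding D_def P'_def quartic_pairs_def by (auto simp: image_iff)
  have disj: "D \<inter> (quartic_pairs N \<union> P') = {}" "quartic_pairs N \<inter> P' = {}"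
    unfolding D_def P'_def quartic_pairs_def by auto
  have fin: "finite D" "finite (quartic_pairs N)" "finite P'"
    unfolding D_def P'_def by (simp_all add: finite_quartic_pairs)
  have diag: "(\<Sum>(m, n)\<in>D. ?t m n) = of_real (real N * measure unit_leb G)"
  proof -
    have "a n * cnj (a n) = 1" if "n \<in> {1..N}" for n
      using a[of n] that complex_norm_square[of "a n"] by simp
    then have "(\<Sum>(m, n)\<in>D. ?t m n) = (\<Sum>n = 1..N. fourier_coeff G 0)"
      unfolding D_def by (subst sum.reindex) (auto simp: inj_on_def intro!: sum.cong)
    then show ?thesis using fourier_coeff_0[OF G] by simp
  qed
  have diff: "fourier_coeff G (int n ^ 4 - int m ^ 4) = fourier_coeff G (int (quartic_diff (m, n)))"
    if "(m, n) \<in> quartic_pairs N" for m n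
  proof -
    have "m ^ 4 \<le> n ^ 4" using that unfolding quartic_pairs_def by (intro power_mono) auto
    then show ?thesis unfolding quartic_diff_def by (simp add: of_nat_diff)
  qed
  have low: "norm (\<Sum>(m, n)\<in>P'. ?t m n) \<le> (\<Sum>p\<in>quartic_pairs N. norm (fourier_coeff G (int (quartic_diff p))))"
  proof -
    have "(\<Sum>(m, n)\<in>P'. ?t m n) = (\<Sum>(m, n)\<in>quartic_pairs N. ?t n m)"
      unfolding P'_def by (subst sum.reindex) (auto simp: inj_on_def intro!: sum.cong)
    also have "norm \<dots> \<le> (\<Sum>p\<in>quartic_pairs N. norm (fourier_coeff G (int (quartic_diff p))))"
    proof (rule sum_norm_le)
      fix p assume p: "p \<in> quartic_pairs N"
      obtain m n where mn: "p = (m, n)" by fastforce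
      have "norm (a m) = 1" "norm (a n) = 1"
        using p a unfolding mn quartic_pairs_def by auto
      then show "norm (case p of (m, n) \<Rightarrow> ?t n m) \<le> norm (fourier_coeff G (int (quartic_diff p)))"
        using diff[OF p[unfolded mn]] unfolding mn by (simp add: norm_mult)
    qed
    finally show ?thesis .
  qed
  have up: "norm (\<Sum>(m, n)\<in>quartic_pairs N. ?t m n) \<le> (\<Sum>p\<in>quartic_pairs N. norm (fourier_coeff G (int (quartic_diff p))))"
  proof (rule sum_norm_le)
    fix p assume p: "p \<in> quartic_pairs N"
    obtain m n where mn: "p = (m, n)" by fastforce
    have n1: "norm (a m) = 1" "norm (a n) = 1"
      using p a unfolding mn quartic_pairs_def by auto
    have "fourier_coeff G (int m ^ 4 - int n ^ 4) = cnj (fourier_coeff G (int n ^ 4 - int m ^ 4))"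
      unfolding fourier_coeff_minus[symmetric] by simp
    then show "norm (case p of (m, n) \<Rightarrow> ?t m n) \<le> norm (fourier_coeff G (int (quartic_diff p)))"
      using diff[OF p[unfolded mn]] n1 unfolding mn by (simp add: norm_mult)
  qed
  have "of_real ?J = (\<Sum>(m, n)\<in>{1..N} \<times> {1..N}. ?t m n)"
    unfolding integral_indicator_weyl_sum_squared(1)[OF G] by (rule sum.cartesian_product)
  also have "\<dots> = of_real (real N * measure unit_leb G) + ((\<Sum>(m, n)\<in>quartic_pairs N. ?t m n) + (\<Sum>(m, n)\<in>P'. ?t m n))"
    unfolding split diag[symmetric] using disj fin by (simp add: sum.union_disjoint)
  finally have J: "complex_of_real (?J - real N * measure unit_leb G)
      = (\<Sum>(m, n)\<in>quartic_pairs N. ?t m n) + (\<Sum>(m, n)\<in>P'. ?t m n)"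
    by simp
  have "\<bar>?J - real N * measure unit_leb G\<bar>
      = norm ((\<Sum>(m, n)\<in>quartic_pairs N. ?t m n) + (\<Sum>(m, n)\<in>P'. ?t m n))"
    unfolding J[symmetric] norm_of_real ..
  also have "\<dots> \<le> norm (\<Sum>(m, n)\<in>quartic_pairs N. ?t m n) + norm (\<Sum>(m, n)\<in>P'. ?t m n)"
    by (rule norm_triangle_ineq)
  finally show ?thesis using low up by linarith
qed

lemma measure_zero_of_weyl_sum_bound:
  assumes G: "G \<in> sets unit_leb" and a: "\<And>n. n \<ge> 1 \<Longrightarrow> norm (a n) = 1"
    and c: "0 < c" "c < 1"
    and bound: "\<And>x N. x \<in> G \<Longrightarrow> N \<ge> K \<Longrightarrow> norm (weyl_sum a 4 N x) < c * sqrt (real N)"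
  shows "measure unit_leb G = 0"
proof (rule ccontr)
  assume "measure unit_leb G \<noteq> 0"
  then have g: "measure unit_leb G > 0" by (simp add: zero_less_measure_iff)
  define h where "h k = norm (fourier_coeff G (int k))" for k
  have hB: "(\<Sum>k\<in>K. (h k)\<^sup>2) \<le> measure unit_leb G" if "finite K" for K
    using bessel_inequality[OF G, of "int ` K"] that
    by (simp add: sum.reindex h_def)
  \<comment> \<open>A quarter of the gap between the diagonal term and the assumed upper bound, both
    per unit of \<open>N\<close>: the two off-diagonal parts use up only half of the gap.\<close>
  define \<epsilon> where "\<epsilon> = measure unit_leb G * (1 - c\<^sup>2) / 4"
  have "c\<^sup>2 < 1" using c by (simp add: power_less_one_iff)
  then have "\<epsilon> > 0" unfolding \<epsilon>_def using g by simp
  from sum_quartic_diff_small[of h, OF _ hB this]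
  obtain Q where Q: "\<And>q. q \<ge> Q \<Longrightarrow> (\<Sum>p\<in>quartic_pairs (q ^ 54). h (quartic_diff p)) \<le> \<epsilon> * real (q ^ 54)"
    unfolding h_def by auto
  \<comment> \<open>Beyond \<open>Q\<close> for the off-diagonal estimate, and beyond
    \<open>K\<close> so that \<open>N >= q\<close> lies in the range of the assumed bound.\<close>
  define q where "q = Q + K + 1"
  define N where "N = q ^ 54"
  have "q > 0" unfolding q_def by simp
  then have "N > 0" "q \<le> N" unfolding N_def by (auto intro: self_le_power)
  then have "N \<ge> K" unfolding q_def by simp
  have "(\<integral>x. indicator G x * norm (weyl_sum a 4 N x) ^ 2 \<partial>unit_leb)
      \<le> (\<integral>x. indicator G x * (c\<^sup>2 * real N) \<partial>unit_leb)"
  proof (rule integral_mono)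
    show "integrable unit_leb (\<lambda>x. indicator G x * norm (weyl_sum a 4 N x) ^ 2)"
      by (rule integral_indicator_weyl_sum_squared(2)[OF G])
    have "emeasure unit_leb G < \<infinity>"
      using finite_measure.emeasure_finite[OF finite_measure_unit_leb] by (simp add: top.not_eq_extremum)
    then show "integrable unit_leb (\<lambda>x. indicator G x * (c\<^sup>2 * real N))"
      using G by (intro integrable_mult_left integrable_real_indicator)
    show "indicator G x * norm (weyl_sum a 4 N x) ^ 2 \<le> indicator G x * (c\<^sup>2 * real N)" for x
    proof (cases "x \<in> G")
      case True
      have "norm (weyl_sum a 4 N x) ^ 2 \<le> (c * sqrt (real N)) ^ 2"
        using bound[OF True \<open>N \<ge> K\<close>] by (intro power_mono) auto
      then show ?thesis using True by (simp add: power_mult_distrib)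
    qed simp
  qed
  also have "\<dots> = measure unit_leb G * (c\<^sup>2 * real N)"
    using G sets.sets_into_space[OF G] by (simp add: Int_absorb2)
  finally have "real N * measure unit_leb G - 2 * (\<epsilon> * real N) \<le> measure unit_leb G * (c\<^sup>2 * real N)"
    using integral_weyl_sum_squared_ge[OF G a, where N = N] Q[of q] unfolding N_def h_def q_def by force
  then have "real N * (measure unit_leb G * (1 - c\<^sup>2) - 2 * \<epsilon>) \<le> 0"
    by (simp add: algebra_simps)
  moreover have "measure unit_leb G * (1 - c\<^sup>2) - 2 * \<epsilon> = 2 * \<epsilon>"
    unfolding \<epsilon>_def by simp
  ultimately show False using \<open>N > 0\<close> \<open>\<epsilon> > 0\<close> by (simp add: mult_le_0_iff)
qed

section \<open>Full measure in every interval, and the stated lower bound\<close>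

theorem theorem2p2:
  fixes a :: "nat \<Rightarrow> complex" and c :: real and I :: "real set"
  assumes "0 < c" and "c < 1"
    and "\<And>n. n \<ge> 1 \<Longrightarrow> norm (a n) = 1"
    and "is_interval I" and "I \<subseteq> {0..<1}"
  shows "measure lebesgue (F a c 4 \<inter> I) \<ge> (measure lebesgue I * (1 - c\<^sup>2))\<^sup>2 / 8"
proof -
  have I_sub: "I \<subseteq> {0..1}"
    by (rule order_trans[OF assms(5)]) auto
  then have "bounded I"
    by (rule bounded_subset[OF bounded_closed_interval])
  then have I: "I \<in> lmeasurable"
    using is_interval_convex[OF assms(4)] by (rule measurable_convex[rotated])
  define G where "G M = {x \<in> I. \<forall>N\<ge>M. norm (weyl_sum a 4 N x) < c * sqrt (real N)}" for M
  have G_sets: "G M \<in> sets lebesgue" for M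
  proof -
    have "{x \<in> space borel. \<forall>N\<ge>M. norm (weyl_sum a 4 N x) < c * sqrt (real N)} \<in> sets borel"
      by measurable
    then have "{x. \<forall>N\<ge>M. norm (weyl_sum a 4 N x) < c * sqrt (real N)} \<in> sets lebesgue"
      by (simp add: sets_completionI_sets)
    moreover have "G M = I \<inter> {x. \<forall>N\<ge>M. norm (weyl_sum a 4 N x) < c * sqrt (real N)}"
      unfolding G_def by auto
    ultimately show ?thesis using I by (simp add: fmeasurableD sets.Int)
  qed
  have "G M \<in> null_sets lebesgue" for M
  proof -
    have sub: "G M \<subseteq> {0..1}" using I_sub unfolding G_def by blast
    then have G_unit: "G M \<in> sets unit_leb"
      using G_sets by (simp add: sets_restrict_space_iff)
    have "measure unit_leb (G M) = 0"
      by (rule measure_zero_of_weyl_sum_bound[OF G_unit assms(3,1,2), where K = M]) (auto simp: G_def)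
    then have "measure lebesgue (G M) = 0"
      using sub by (simp add: measure_restrict_space)
    moreover have "G M \<in> lmeasurable"
      using fmeasurableI2[OF I _ G_sets] unfolding G_def by auto
    ultimately show ?thesis
      by (simp add: negligible_iff_measure flip: negligible_iff_null_sets)
  qed
  then have null: "(\<Union>M. G M) \<in> null_sets lebesgue" by (intro null_sets_UN)
  \<comment> \<open>A point of \<open>I\<close> lies outside \<open>F a c 4\<close> exactly when the
    reverse strict inequality holds for all \<open>N\<close> from some \<open>M\<close> on.\<close>
  have eq: "F a c 4 \<inter> I = I - (\<Union>M. G M)"
    using assms(5) unfolding F_def G_def infinite_nat_iff_unbounded_le by (auto simp: not_le[symmetric])
  have "measure lebesgue (F a c 4 \<inter> I) = measure lebesgue I"
    unfolding eq using I null by (intro measure_Diff_null_set) (auto simp: fmeasurableD)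
  \<comment> \<open>With \<open>l\<close> the measure of \<open>I\<close>, both \<open>l\<close> and
    \<open>1 - c^2\<close> lie in \<open>[0, 1]\<close>, so
    \<open>(l (1 - c^2))^2 <= l^2 <= l\<close>.\<close>
  moreover have "(measure lebesgue I * (1 - c\<^sup>2))\<^sup>2 / 8 \<le> measure lebesgue I"
  proof -
    have "measure lebesgue I \<le> measure lebesgue {0..1::real}"
      using I_sub I by (intro measure_mono_fmeasurable) (auto simp: fmeasurableD)
    then have l: "0 \<le> measure lebesgue I" "measure lebesgue I \<le> 1" by auto
    have "c\<^sup>2 \<le> 1" using assms(1,2) by (simp add: power_le_one)
    then have t: "0 \<le> measure lebesgue I * (1 - c\<^sup>2)" "measure lebesgue I * (1 - c\<^sup>2) \<le> measure lebesgue I"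
      using l(1) by (auto intro: mult_left_le)
    then have "(measure lebesgue I * (1 - c\<^sup>2))\<^sup>2 \<le> (measure lebesgue I)\<^sup>2"
      by (intro power_mono)
    also have "\<dots> \<le> measure lebesgue I"
      using l by (simp add: power2_eq_square mult_left_le)
    finally show ?thesis using l(1) by linarith
  qed
  ultimately show ?thesis by simp
qed

end
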